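(* Let $0<p<1$. In a random series-parallel network of size $n$ generated by the Bernoulli model with parameter $p$, let $L_n$ be the length of a random source-to-sink path, $L_n^{[L]}$ the length of the leftmost source-to-sink path, and $D_n$ the degree of the source. Then $L_n\stackrel{(d)}{=}L_n^{[L]}$; consequently \[ \mathbb{P}\{L_n=m\}=\sum_{j=0}^{m-1}\binom{m-1}{j}(-1)^{n+j-1}\binom{j-p(j+1)}{n-1}\ (1\le m\le n),\qquad \frac{L_n}{n^{1-p}}\xrightarrow{(d)}\text{Mittag-Leffler}(1-p). \] Furthermore, for $1\le \ell,m\le n$, \[ \mathbb{P}\{L_n=m \text{ and } D_n=\ell\}=\sum_{i=0}^{m-1}\sum_{j=0}^{\ell-1}\binom{m-1}{i}\binom{\ell-1}{j}(-1)^{n+i+j-1}\binom{(1-p)i+pj}{n-1}. \]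
   Context: Bernoulli model (parameter $0<p<1$): a series-parallel network is a directed multigraph with a source and a sink; its size is its number of edges; the outgoing edges of each node carry a left-to-right order. At step $1$ the network is a single edge from source to sink. At step $n\ge2$ one of the $n-1$ edges, say $e=(x,y)$, is chosen uniformly at random; independently, with probability $p$ a new edge $(x,y)$ is inserted immediately to the right of $e$ among the outgoing edges of $x$, and with probability $1-p$ the edge $e$ is replaced by $(x,z)$ (in the position of $e$) followed by $(z,y)$, with $z$ a new node. A random source-to-sink path starts at the source and, at each node of out-degree $d\ge1$, follows one of its $d$ outgoing edges chosen uniformly at random (independently), until the sink is reached; length is the number of edges. The leftmost path always follows the leftmost outgoing edge. For real $x$, $\binom{x}{k}=x(x-1)\cdots(x-k+1)/k!$. Mittag-Leffler$(\alpha)$ denotes the distribution with $r$-th moments $r!/\Gamma(r\alpha+1)$. *)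

theory Defs
  imports "HOL-Probability.Probability"
begin

text \<open>
  A network stores for each node \<open>x\<close> the left-to-right list \<open>out N x\<close> of the end points of its
  outgoing edges. The edge at position \<open>i\<close> of that list is identified with the pair \<open>(x, i)\<close>, so
  parallel edges are repeated entries of the list and remain distinguishable.
\<close>

record network =
  source :: nat
  sink :: nat
  nodes :: "nat set"
  out :: "nat \<Rightarrow> nat list"

type_synonym edge = "nat \<times> nat"

definition outdegree :: "network \<Rightarrow> nat \<Rightarrow> nat" where
  "outdegree N x = length (out N x)"

definition edges :: "network \<Rightarrow> edge set" where
  "edges N = (SIGMA x:nodes N. {..<outdegree N x})"

definition target :: "network \<Rightarrow> edge \<Rightarrow> nat" where
  "target N e = out N (fst e) ! snd e"

definition single_edge :: network where
  "single_edge = \<lparr>source = 0, sink = 1, nodes = {0, 1}, out = (\<lambda>_. [])(0 := [1])\<rparr>"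

definition parallel_step :: "edge \<Rightarrow> network \<Rightarrow> network" where
  "parallel_step e N =
     (let (x, i) = e; es = out N x
      in N\<lparr>out := (out N)(x := take (Suc i) es @ [es ! i] @ drop (Suc i) es)\<rparr>)"

definition fresh_node :: "network \<Rightarrow> nat" where
  "fresh_node N = Suc (Max (nodes N))"

definition serial_step :: "edge \<Rightarrow> network \<Rightarrow> network" where
  "serial_step e N =
     (let (x, i) = e; z = fresh_node N
      in N\<lparr>nodes := insert z (nodes N),
           out := (out N)(x := (out N x)[i := z], z := [out N x ! i])\<rparr>)"

definition bernoulli_step :: "real \<Rightarrow> network \<Rightarrow> network pmf" where
  "bernoulli_step p N =
     do {
       e \<leftarrow> pmf_of_set (edges N);
       b \<leftarrow> bernoulli_pmf p;
       return_pmf (if b then parallel_step e N else serial_step e N)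
     }"

text \<open>The index is the size of the network; the value at index 0 is irrelevant.\<close>

primrec bernoulli_network :: "real \<Rightarrow> nat \<Rightarrow> network pmf" where
  "bernoulli_network p 0 = return_pmf single_edge"
| "bernoulli_network p (Suc n) =
     (if n = 0 then return_pmf single_edge
      else bind_pmf (bernoulli_network p n) (bernoulli_step p))"

definition succ_rel :: "network \<Rightarrow> (nat \<times> nat) set" where
  "succ_rel N = {(y, x). y \<in> set (out N x)}"

text \<open>
  Walks stop at the sink. The other two stopping conditions only make the recursions below total;
  lemma \<open>stopped_bernoulli_network\<close> shows that they are never met in the networks considered here.
\<close>

definition stopped :: "network \<Rightarrow> nat \<Rightarrow> bool" where
  "stopped N x \<longleftrightarrow> x = sink N \<or> out N x = [] \<or> \<not> wf (succ_rel N)"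

definition walk_rel :: "((network \<times> nat) \<times> network \<times> nat) set" where
  "walk_rel = {((M, y), (N, x)). M = N \<and> wf (succ_rel N) \<and> (y, x) \<in> succ_rel N}"

lemma wf_walk_rel: "wf walk_rel"
proof (rule wfUNIVI)
  fix P :: "network \<times> nat \<Rightarrow> bool" and Nx :: "network \<times> nat"
  assume step: "\<forall>a. (\<forall>b. (b, a) \<in> walk_rel \<longrightarrow> P b) \<longrightarrow> P a"
  obtain N x where Nx: "Nx = (N, x)" by force
  have "P (N, x)"
  proof (cases "wf (succ_rel N)")
    case True
    then show ?thesis
    proof (induction x rule: wf_induct_rule)
      case (less x)
      show ?case by (rule step[rule_format]) (use less in \<open>auto simp: walk_rel_def\<close>)
    qed
  next
    case False
    show ?thesis by (rule step[rule_format]) (use False in \<open>auto simp: walk_rel_def\<close>)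
  qed
  then show "P Nx" by (simp add: Nx)
qed

lemma walk_rel_target:
  "\<not> stopped N x \<Longrightarrow> i < outdegree N x \<Longrightarrow> ((N, target N (x, i)), (N, x)) \<in> walk_rel"
  by (auto simp: stopped_def walk_rel_def succ_rel_def target_def outdegree_def)

function random_path_from :: "network \<Rightarrow> nat \<Rightarrow> edge list pmf" where
  "random_path_from N x =
     (if stopped N x then return_pmf []
      else do {
        i \<leftarrow> pmf_of_set {..<outdegree N x};
        es \<leftarrow> random_path_from N (target N (x, i));
        return_pmf ((x, i) # es)
      })"
  by auto
termination
proof (relation walk_rel)
  fix N x i
  assume "\<not> stopped N x" and "i \<in> set_pmf (pmf_of_set {..<outdegree N x})"
  moreover from this have "{..<outdegree N x} \<noteq> {}"
    by (auto simp: stopped_def outdegree_def)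
  ultimately show "((N, target N (x, i)), (N, x)) \<in> walk_rel"
    by (intro walk_rel_target) (auto simp: set_pmf_of_set)
qed (rule wf_walk_rel)

function leftmost_path_from :: "network \<Rightarrow> nat \<Rightarrow> edge list" where
  "leftmost_path_from N x =
     (if stopped N x then [] else (x, 0) # leftmost_path_from N (target N (x, 0)))"
  by auto
termination
proof (relation walk_rel)
  fix N x
  assume "\<not> stopped N x"
  then show "((N, target N (x, 0)), (N, x)) \<in> walk_rel"
    by (rule walk_rel_target) (use \<open>\<not> stopped N x\<close> in \<open>simp add: stopped_def outdegree_def\<close>)
qed (rule wf_walk_rel)

declare random_path_from.simps [simp del] leftmost_path_from.simps [simp del]

text \<open>The common probability space: a random network together with a random path in it.\<close>

definition network_path :: "real \<Rightarrow> nat \<Rightarrow> (network \<times> edge list) pmf" where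
  "network_path p n =
     do {
       N \<leftarrow> bernoulli_network p n;
       es \<leftarrow> random_path_from N (source N);
       return_pmf (N, es)
     }"

definition path_length :: "network \<times> edge list \<Rightarrow> nat" where
  "path_length \<omega> = length (snd \<omega>)"

definition leftmost_path_length :: "network \<times> edge list \<Rightarrow> nat" where
  "leftmost_path_length \<omega> = length (leftmost_path_from (fst \<omega>) (source (fst \<omega>)))"

text \<open>
  The source never has incoming edges (lemma \<open>source_no_incoming\<close>), so its degree is its
  outdegree.
\<close>

definition source_degree :: "network \<times> edge list \<Rightarrow> nat" where
  "source_degree \<omega> = outdegree (fst \<omega>) (source (fst \<omega>))"

definition mittag_leffler :: "real \<Rightarrow> real measure \<Rightarrow> bool" where
  "mittag_leffler \<alpha> M \<longleftrightarrow> real_distribution M \<and>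
     (\<forall>r. has_bochner_integral M (\<lambda>x. x ^ r) (fact r / Gamma (real r * \<alpha> + 1)))"

definition network_inv :: "nat \<Rightarrow> network \<Rightarrow> bool" where
  "network_inv n N \<longleftrightarrow>
     finite (nodes N) \<and> source N \<in> nodes N \<and> sink N \<in> nodes N \<and> card (edges N) = n \<and>
     (\<forall>x. out N x \<noteq> [] \<longleftrightarrow> x \<in> nodes N \<and> x \<noteq> sink N) \<and>
     (\<forall>x. set (out N x) \<subseteq> nodes N - {source N}) \<and>
     (\<exists>h::nat \<Rightarrow> nat. \<forall>x. \<forall>y\<in>set (out N x). h y < h x)"

lemma card_edges: "finite (nodes N) \<Longrightarrow> card (edges N) = (\<Sum>x\<in>nodes N. outdegree N x)"
  by (simp add: edges_def)

lemma network_inv_single_edge: "network_inv 1 single_edge"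
  by (auto simp: network_inv_def single_edge_def card_edges outdegree_def
           intro!: exI[of _ "\<lambda>x. if x = 0 then 1 else 0"])

lemma network_inv_parallel_step:
  assumes inv: "network_inv n N" and e: "(x, i) \<in> edges N"
  shows "network_inv (Suc n) (parallel_step (x, i) N)"
proof -
  let ?N = "parallel_step (x, i) N"
  from e have x: "x \<in> nodes N" and i: "i < length (out N x)"
    by (auto simp: edges_def outdegree_def)
  have flds: "source ?N = source N" "sink ?N = sink N" "nodes ?N = nodes N"
    by (simp_all add: parallel_step_def Let_def)
  have out: "out ?N x = take (Suc i) (out N x) @ [out N x ! i] @ drop (Suc i) (out N x)"
    "\<And>y. y \<noteq> x \<Longrightarrow> out ?N y = out N y"
    by (simp_all add: parallel_step_def Let_def)
  have set_out: "set (out ?N y) = set (out N y)" for y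
  proof (cases "y = x")
    case True
    have "set (out N x) = set (take (Suc i) (out N x)) \<union> set (drop (Suc i) (out N x))"
      by (metis append_take_drop_id set_append)
    moreover have "out N x ! i \<in> set (out N x)" using i by simp
    ultimately show ?thesis unfolding True out(1) set_append by auto
  qed (simp add: out)
  have fin: "finite (nodes N)" using inv by (simp add: network_inv_def)
  have "outdegree ?N x = Suc (outdegree N x)" using i by (simp add: outdegree_def out)
  moreover have "(\<Sum>y\<in>nodes N - {x}. outdegree ?N y) = (\<Sum>y\<in>nodes N - {x}. outdegree N y)"
    by (intro sum.cong) (auto simp: outdegree_def out)
  ultimately have "card (edges ?N) = Suc (card (edges N))"
    using fin x by (simp add: card_edges flds sum.remove[of _ x])
  moreover have "out ?N y \<noteq> [] \<longleftrightarrow> out N y \<noteq> []" for y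
    using set_out[of y] by (metis set_empty)
  ultimately show ?thesis using inv unfolding network_inv_def flds set_out by simp
qed

lemma network_inv_serial_step:
  assumes inv: "network_inv n N" and e: "(x, i) \<in> edges N"
  shows "network_inv (Suc n) (serial_step (x, i) N)"
proof -
  let ?N = "serial_step (x, i) N" and ?z = "fresh_node N"
  from e have x: "x \<in> nodes N" and i: "i < length (out N x)"
    by (auto simp: edges_def outdegree_def)
  have fin: "finite (nodes N)" using inv by (simp add: network_inv_def)
  then have z: "?z \<notin> nodes N" using Max_ge[of "nodes N" ?z] unfolding fresh_node_def by linarith
  have xz: "x \<noteq> ?z" using x z by auto
  have flds: "source ?N = source N" "sink ?N = sink N" "nodes ?N = insert ?z (nodes N)"
    by (simp_all add: serial_step_def Let_def)
  have out: "out ?N x = (out N x)[i := ?z]" "out ?N ?z = [out N x ! i]"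
    "\<And>y. y \<noteq> x \<Longrightarrow> y \<noteq> ?z \<Longrightarrow> out ?N y = out N y"
    using xz by (simp_all add: serial_step_def Let_def)
  have y: "out N x ! i \<in> set (out N x)" using i by simp
  have ne: "source N \<in> nodes N" "sink N \<in> nodes N"
    and outne: "\<And>w. out N w \<noteq> [] \<longleftrightarrow> w \<in> nodes N \<and> w \<noteq> sink N"
    and sub: "\<And>w. set (out N w) \<subseteq> nodes N - {source N}"
    and size: "card (edges N) = n"
    using inv by (auto simp: network_inv_def)
  obtain h :: "nat \<Rightarrow> nat" where h: "\<And>w v. v \<in> set (out N w) \<Longrightarrow> h v < h w"
    using inv unfolding network_inv_def by metis
  have "(\<Sum>w\<in>nodes N. outdegree ?N w) = (\<Sum>w\<in>nodes N. outdegree N w)"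
  proof (intro sum.cong refl)
    fix w assume "w \<in> nodes N"
    with z have "w \<noteq> ?z" by auto
    then show "outdegree ?N w = outdegree N w" by (cases "w = x") (simp_all add: outdegree_def out)
  qed
  moreover have "outdegree ?N ?z = 1" by (simp add: outdegree_def out)
  ultimately have card: "card (edges ?N) = Suc n"
    using fin z size by (simp add: card_edges flds)
  define h' where "h' w = (if w = ?z then Suc (2 * h (out N x ! i)) else 2 * h w)" for w
  have "(out ?N w \<noteq> [] \<longleftrightarrow> w \<in> insert ?z (nodes N) \<and> w \<noteq> sink N) \<and>
        set (out ?N w) \<subseteq> insert ?z (nodes N) - {source N} \<and>
        (\<forall>v\<in>set (out ?N w). h' v < h' w)" for w
  proof -
    consider "w = ?z" | "w = x" | "w \<noteq> ?z" "w \<noteq> x" by blast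
    then show ?thesis
    proof cases
      case 1
      have "out N x ! i \<in> nodes N - {source N}" using sub[of x] y by blast
      moreover have "sink N \<noteq> ?z" using ne(2) z by metis
      moreover have "out N x ! i \<noteq> ?z" using calculation(1) z by (metis DiffD1)
      ultimately show ?thesis by (simp add: 1 out(2) h'_def)
    next
      case 2
      have "h' v < h' x" if "v \<in> insert ?z (set (out N x))" for v
        using that h[OF y] h[of v x] xz by (cases "v = ?z") (simp_all add: h'_def)
      moreover have "set (out ?N x) \<subseteq> insert ?z (set (out N x))"
        unfolding out(1) by (rule set_update_subset_insert)
      moreover have "source N \<noteq> ?z" using ne z by metis
      moreover have "out ?N x \<noteq> []" using i by (auto simp: out)
      moreover have "x \<noteq> sink N" using outne[of x] i by auto
      ultimately show ?thesis using sub[of x] x unfolding 2 by blast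
    next
      case 3
      have "h' v < h' w" if "v \<in> set (out N w)" for v
      proof -
        have "v \<noteq> ?z" using that sub[of w] z by blast
        with that h[of v w] 3 show ?thesis by (simp add: h'_def)
      qed
      with outne[of w] sub[of w] 3 show ?thesis unfolding out(3)[OF 3(2,1)] by blast
    qed
  qed
  then show ?thesis
    using fin ne card unfolding network_inv_def flds by blast
qed

lemma network_inv_bernoulli_network:
  assumes "n \<ge> 1" "N \<in> set_pmf (bernoulli_network p n)"
  shows "network_inv n N"
  using assms
proof (induction n arbitrary: N)
  case (Suc n)
  show ?case
  proof (cases "n = 0")
    case True
    with Suc.prems network_inv_single_edge show ?thesis by simp
  next
    case False
    with Suc.prems obtain M where M: "M \<in> set_pmf (bernoulli_network p n)"
      and N: "N \<in> set_pmf (bernoulli_step p M)" by auto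
    from False M have inv: "network_inv n M" by (intro Suc.IH) auto
    with False have "edges M \<noteq> {}" "finite (edges M)"
      by (auto simp: network_inv_def intro: card_ge_0_finite)
    with N have "\<exists>e\<in>edges M. N = parallel_step e M \<or> N = serial_step e M"
      unfolding bernoulli_step_def set_bind_pmf by (auto simp: set_pmf_of_set split: if_splits)
    then obtain x i where e: "(x, i) \<in> edges M"
      and "N = parallel_step (x, i) M \<or> N = serial_step (x, i) M" by auto
    with network_inv_parallel_step[OF inv e] network_inv_serial_step[OF inv e]
    show ?thesis by auto
  qed
qed simp

lemma card_edges_bernoulli_network:
  "n \<ge> 1 \<Longrightarrow> N \<in> set_pmf (bernoulli_network p n) \<Longrightarrow> card (edges N) = n"
  using network_inv_bernoulli_network[of n N p] by (simp add: network_inv_def)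

lemma source_no_incoming:
  "n \<ge> 1 \<Longrightarrow> N \<in> set_pmf (bernoulli_network p n) \<Longrightarrow> source N \<notin> set (out N x)"
  using network_inv_bernoulli_network[of n N p] unfolding network_inv_def by blast

lemma stopped_bernoulli_network:
  assumes "n \<ge> 1" "N \<in> set_pmf (bernoulli_network p n)" "x \<in> nodes N"
  shows "stopped N x \<longleftrightarrow> x = sink N"
proof -
  have inv: "network_inv n N" using network_inv_bernoulli_network assms by auto
  then obtain h :: "nat \<Rightarrow> nat" where "\<And>w v. v \<in> set (out N w) \<Longrightarrow> h v < h w"
    unfolding network_inv_def by metis
  then have "succ_rel N \<subseteq> Wellfounded.measure h" by (auto simp: succ_rel_def)
  then have "wf (succ_rel N)" by (rule wf_subset[OF wf_measure])
  moreover have "out N x \<noteq> [] \<longleftrightarrow> x \<in> nodes N \<and> x \<noteq> sink N"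
    using inv unfolding network_inv_def by blast
  ultimately show ?thesis using assms(3) by (auto simp: stopped_def)
qed

end

theory Submission
  imports Defs "HOL-Combinatorics.Stirling" "HOL-Real_Asymp.Real_Asymp"
begin

text \<open>
  Doubling a uniformly chosen edge of a node does not change the law of the length of a random path,
  while subdividing an edge lengthens the path by one exactly if the edge lies on it. Hence, jointly
  with the source degree \<open>l\<close>, the path length \<open>m\<close> is a Markov chain: in a network of size \<open>n\<close> it
  increases with probability \<open>(1 - p) m / n\<close>, and \<open>l\<close> increases with probability \<open>p l / n\<close>. The length
  of the leftmost path has the same transitions. Alternating binomial sums diagonalise this chain,
  which gives the explicit formulas. The rising factorials of the length have explicit means, so its
  rescaled moments converge to \<open>r! / \<Gamma>(r (1 - p) + 1)\<close>. These grow slowly enough to determine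
  the distribution, and Helly's selection theorem gives existence of the limit law as well as
  convergence to it.
\<close>

text \<open>Doubling one fixed edge biases the random path towards that edge, so the law of the
  length can change when the edge is prescribed. The remedy is to condition only on the tail of the
  chosen edge and to redraw its position: the bias averages out over the edges leaving that tail,
  while the tail alone decides whether the source degree grows. Serial steps and the leftmost path
  need no averaging; there each edge is treated on its own.

  The arguments of the binomial coefficients come from decay rates. Mode \<open>j\<close> of the
  length chain has rate (1 - p)(j + 1), and j - p(j + 1) is this rate minus one. In the joint chain
  the rates (1 - p)(i + 1) and p(j + 1) add up, and subtracting one leaves (1 - p)i + pj.

  In the uniqueness argument the factorial in the moments cancels against the factorial in the
  Taylor expansion of the characteristic function. What remains is that Gamma outgrows every
  geometric sequence.\<close>

section \<open>Uniform choices: redrawing within fibres, membership in a subset, duplication of a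
  point\<close>

text \<open>Each of the \<open>card (B x)\<close> points over \<open>x\<close> passes the fraction 1
  / \<open>card (B x)\<close> of its mass to every point over \<open>x\<close>, so redrawing the
  second coordinate leaves the uniform law invariant. For edges, this redraws the position of the
  edge among all edges with the same tail.\<close>

lemma resample_pmf_of_set_Sigma:
  fixes A :: "'a set" and B :: "'a \<Rightarrow> 'b set"
  assumes "finite (Sigma A B)" "Sigma A B \<noteq> {}"
  shows "pmf_of_set (Sigma A B) \<bind> (\<lambda>e. pmf_of_set (B (fst e)) \<bind> (\<lambda>i. f (fst e, i)))
    = pmf_of_set (Sigma A B) \<bind> f"
proof -
  have "pmf_of_set (Sigma A B) \<bind> (\<lambda>e. map_pmf (Pair (fst e)) (pmf_of_set (B (fst e))))
    = pmf_of_set (Sigma A B)" (is "?p = ?q")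
  proof (rule pmf_eqI)
    fix e :: "'a \<times> 'b"
    obtain x i where e: "e = (x, i)" by force
    have fin: "finite (B (fst e'))" and ne: "B (fst e') \<noteq> {}" if "e' \<in> Sigma A B" for e'
    proof -
      have "Pair (fst e') ` B (fst e') \<subseteq> Sigma A B" using that by auto
      then show "finite (B (fst e'))"
        using finite_imageD[of "Pair (fst e')"] finite_subset[OF _ assms(1)] by (auto simp: inj_on_def)
      show "B (fst e') \<noteq> {}" using that by auto
    qed
    have "pmf ?p e = (\<Sum>e'\<in>Sigma A B. pmf (map_pmf (Pair (fst e')) (pmf_of_set (B (fst e')))) e)
        / card (Sigma A B)"
      using assms by (intro pmf_bind_pmf_of_set) auto
    also have "(\<Sum>e'\<in>Sigma A B. pmf (map_pmf (Pair (fst e')) (pmf_of_set (B (fst e')))) e)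
        = (\<Sum>e'\<in>Sigma A B. if fst e' = x then indicator (B x) i / card (B x) else 0)"
    proof (intro sum.cong refl)
      fix e' assume e': "e' \<in> Sigma A B"
      show "pmf (map_pmf (Pair (fst e')) (pmf_of_set (B (fst e')))) e
          = (if fst e' = x then indicator (B x) i / card (B x) else 0)"
      proof (cases "fst e' = x")
        case True
        have "pmf (map_pmf (Pair x) (pmf_of_set (B x))) (Pair x i) = pmf (pmf_of_set (B x)) i"
          by (intro pmf_map_inj') (auto simp: inj_on_def)
        with True fin[OF e'] ne[OF e'] show ?thesis by (simp add: e)
      next
        case False
        then have "pmf (map_pmf (Pair (fst e')) (pmf_of_set (B (fst e')))) e = 0"
          by (intro pmf_map_outside) (auto simp: e)
        with False show ?thesis by simp
      qed
    qed
    also have "\<dots> = (\<Sum>e'\<in>{e' \<in> Sigma A B. fst e' = x}. indicator (B x) i / card (B x))"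
      using assms(1) by (rule sum.inter_filter[symmetric])
    also have "{e' \<in> Sigma A B. fst e' = x} = (if x \<in> A then Pair x ` B x else {})"
      by auto
    also have "(\<Sum>e'\<in>\<dots>. indicator (B x) i / card (B x)) = indicator (Sigma A B) e"
    proof (cases "(x, i) \<in> Sigma A B")
      case True
      then have "card (Pair x ` B x) = card (B x)" "card (B x) > 0"
        using fin[OF True] ne[OF True] by (auto simp: card_image inj_on_def card_gt_0_iff)
      with True show ?thesis by (simp add: e)
    qed (auto simp: e)
    also have "\<dots> / card (Sigma A B) = pmf ?q e"
      using assms by simp
    finally show "pmf ?p e = pmf ?q e" .
  qed
  then have "?p \<bind> f = ?q \<bind> f" by simp
  then show ?thesis
    by (simp add: bind_assoc_pmf bind_map_pmf)
qed

lemma map_pmf_of_set_mem: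
  assumes "finite E" "E \<noteq> {}" "S \<subseteq> E"
  shows "map_pmf (\<lambda>e. e \<in> S) (pmf_of_set E) = bernoulli_pmf (card S / card E)"
proof (rule pmf_eqI)
  fix b
  have c: "card S \<le> card E" "card E > 0" using assms by (auto simp: card_mono card_gt_0_iff)
  have S: "E \<inter> ((\<lambda>e. e \<in> S) -` {True}) = S" "E \<inter> ((\<lambda>e. e \<in> S) -` {False}) = E - S"
    using assms by auto
  have cd: "card (E - S) = card E - card S"
    using assms by (simp add: card_Diff_subset finite_subset)
  show "pmf (map_pmf (\<lambda>e. e \<in> S) (pmf_of_set E)) b = pmf (bernoulli_pmf (card S / card E)) b"
    using c assms(1,2) S cd
    by (cases b) (simp_all add: pmf_map measure_pmf_of_set of_nat_diff field_simps)
qed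

text \<open>After doubling position \<open>i\<close>, the entry at position \<open>j\<close> is a
  copy of the old entry \<open>if j \<le> i then j else j - 1\<close>. The old entry
  \<open>k\<close> is reached from j = k when k \<le> i and from j = k + 1 when i \<le> k. Summed
  over all \<open>i\<close> this gives (d - k) + (k + 1) = d + 1 hits, independent of
  \<open>k\<close>.\<close>

lemma uniform_after_duplication:
  assumes "d > 0"
  shows "pmf_of_set {..<d} \<bind>
      (\<lambda>i. map_pmf (\<lambda>j. if j \<le> i then j else j - 1) (pmf_of_set {..<Suc d}))
    = pmf_of_set {..<d}"
proof (rule pmf_eqI)
  fix k
  let ?r = "\<lambda>i j::nat. if j \<le> i then j else j - 1"
  let ?p = "pmf_of_set {..<d} \<bind> (\<lambda>i. map_pmf (?r i) (pmf_of_set {..<Suc d}))"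
  have *: "card ({..<Suc d} \<inter> ?r i -` {k}) =
      (if k < d then of_bool (k \<le> i) + of_bool (i \<le> k) else 0)" if i: "i < d" for i
  proof -
    have "{..<Suc d} \<inter> ?r i -` {k} =
        (if k < d then (if k \<le> i then {k} else {}) \<union> (if i \<le> k then {Suc k} else {}) else {})"
      using i by (auto split: if_splits)
    then show ?thesis by auto
  qed
  have "pmf ?p k = (\<Sum>i<d. pmf (map_pmf (?r i) (pmf_of_set {..<Suc d})) k) / card {..<d}"
    using assms by (intro pmf_bind_pmf_of_set) auto
  also have "(\<Sum>i<d. pmf (map_pmf (?r i) (pmf_of_set {..<Suc d})) k)
      = (\<Sum>i<d. card ({..<Suc d} \<inter> ?r i -` {k}) / Suc d)"
    by (intro sum.cong refl) (subst pmf_map, subst measure_pmf_of_set, auto)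
  also have "\<dots> = (\<Sum>i<d. if k < d then of_bool (k \<le> i) + of_bool (i \<le> k) else 0) / Suc d"
    unfolding sum_divide_distrib
    by (intro sum.cong refl) (simp only: *[OF iffD1[OF lessThan_iff]] of_nat_add of_nat_of_bool of_nat_0
        if_distrib[of real])
  also have "(\<Sum>i<d. if k < d then of_bool (k \<le> i) + of_bool (i \<le> k) else (0::real))
      = (if k < d then Suc d else 0)"
  proof (cases "k < d")
    case True
    have 1: "{..<d} \<inter> {i. k \<le> i} = {k..<d}" "{..<d} \<inter> {i. i \<le> k} = {..k}" using True by auto
    show ?thesis using True
      by (simp add: sum.distrib sum.If_cases of_bool_def 1 of_nat_diff)
  qed simp
  finally show "pmf ?p k = pmf (pmf_of_set {..<d}) k"
    using assms by (auto simp: pmf_of_set lessThan_empty_iff indicator_def)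
qed

subsection \<open>Paths in a network\<close>

lemma wf_succ_rel: "network_inv n N \<Longrightarrow> wf (succ_rel N)"
proof -
  assume "network_inv n N"
  then obtain h :: "nat \<Rightarrow> nat" where "\<And>w v. v \<in> set (out N w) \<Longrightarrow> h v < h w"
    unfolding network_inv_def by metis
  then have "succ_rel N \<subseteq> Wellfounded.measure h" by (auto simp: succ_rel_def)
  then show ?thesis by (rule wf_subset[OF wf_measure])
qed

lemma stopped_iff: "network_inv n N \<Longrightarrow> stopped N x \<longleftrightarrow> out N x = []"
  using wf_succ_rel[of n N] unfolding stopped_def network_inv_def by blast

lemma random_path_from_rec:
  assumes "network_inv n N"
  shows "random_path_from N x = (if out N x = [] then return_pmf []
    else pmf_of_set {..<length (out N x)} \<bind>
      (\<lambda>i. map_pmf (Cons (x, i)) (random_path_from N (out N x ! i))))"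
  by (subst random_path_from.simps)
    (simp add: stopped_iff[OF assms] target_def outdegree_def map_pmf_def)

lemma leftmost_path_from_rec:
  assumes "network_inv n N"
  shows "leftmost_path_from N x = (if out N x = [] then []
    else (x, 0) # leftmost_path_from N (out N x ! 0))"
  by (subst leftmost_path_from.simps) (simp add: stopped_iff[OF assms] target_def)

lemma network_induct [consumes 1, case_names step]:
  assumes "network_inv n N"
    and "\<And>x. (\<And>i. i < length (out N x) \<Longrightarrow> P (out N x ! i)) \<Longrightarrow> P x"
  shows "P x"
  using wf_succ_rel[OF assms(1)]
proof (induction x rule: wf_induct_rule)
  case (less x)
  show ?case by (rule assms(2), rule less) (simp add: succ_rel_def)
qed

text \<open>Transfers to the leftmost path whatever holds for every possible random path: its edges
  are distinct, belong to the network and never return to their tail.\<close>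

lemma leftmost_path_from_possible:
  assumes "network_inv n N"
  shows "leftmost_path_from N x \<in> set_pmf (random_path_from N x)"
  using assms
proof (induction x rule: network_induct)
  case (step x)
  show ?case
  proof (cases "out N x = []")
    case False
    then have "0 \<in> {..<length (out N x)}" by simp
    moreover have "set_pmf (pmf_of_set {..<length (out N x)}) = {..<length (out N x)}"
      using False by (intro set_pmf_of_set) auto
    ultimately show ?thesis using False step[of 0]
      by (subst leftmost_path_from_rec[OF assms], subst random_path_from_rec[OF assms]) auto
  qed (simp add: leftmost_path_from_rec[OF assms] random_path_from_rec[OF assms])
qed

text \<open>Pairs in \<open>succ_rel\<close> have the successor first, so \<open>(x, u)\<close> in
  its reflexive transitive closure means that \<open>x\<close> is reachable from
  \<open>u\<close>.\<close>

lemma random_path_from_visits: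
  assumes "network_inv n N" "es \<in> set_pmf (random_path_from N u)" "(x, i) \<in> set es"
  shows "(x, u) \<in> (succ_rel N)\<^sup>*" "i < length (out N x)"
proof -
  have "\<forall>es\<in>set_pmf (random_path_from N u). \<forall>(x, i)\<in>set es.
    (x, u) \<in> (succ_rel N)\<^sup>* \<and> i < length (out N x)"
    using assms(1)
  proof (induction u rule: network_induct)
    case (step u)
    show ?case
    proof (cases "out N u = []")
      case False
      have s: "set_pmf (pmf_of_set {..<length (out N u)}) = {..<length (out N u)}"
        using False by (intro set_pmf_of_set) auto
      have "(out N u ! j, u) \<in> succ_rel N" if "j < length (out N u)" for j
        using that by (simp add: succ_rel_def)
      with step False show ?thesis
        by (subst random_path_from_rec[OF assms(1)])
          (fastforce simp: s intro: rtrancl.rtrancl_into_rtrancl)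
    qed (simp add: random_path_from_rec[OF assms(1)])
  qed
  with assms(2,3) show "(x, u) \<in> (succ_rel N)\<^sup>*" "i < length (out N x)" by force+
qed

lemma random_path_from_avoids:
  assumes "network_inv n N" "y \<in> set (out N x)" "es \<in> set_pmf (random_path_from N y)"
  shows "(x, i) \<notin> set es"
proof
  assume "(x, i) \<in> set es"
  moreover have "(y, x) \<in> succ_rel N" using assms(2) by (simp add: succ_rel_def)
  ultimately have "(x, x) \<in> (succ_rel N)\<^sup>+"
    using random_path_from_visits(1)[OF assms(1,3)] by (meson rtrancl_into_trancl1)
  with wf_succ_rel[OF assms(1)] show False by (meson acyclic_def wf_acyclic)
qed

lemma random_path_from_edges:
  assumes "network_inv n N" "es \<in> set_pmf (random_path_from N u)"
  shows "set es \<subseteq> edges N"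
proof
  fix e assume e: "e \<in> set es"
  obtain x i where [simp]: "e = (x, i)" by force
  have "i < length (out N x)" using random_path_from_visits(2)[OF assms] e by simp
  moreover from this have "x \<in> nodes N" using assms(1) unfolding network_inv_def by force
  ultimately show "e \<in> edges N" by (simp add: edges_def outdegree_def)
qed

text \<open>Acyclicity forbids a return to the first node. Distinctness turns the length of a path
  into the number of its edges, hence into the probability that a uniform edge lies on it.\<close>

lemma distinct_random_path_from:
  assumes "network_inv n N" "es \<in> set_pmf (random_path_from N u)"
  shows "distinct es"
  using assms
proof (induction u arbitrary: es rule: network_induct)
  case (step u)
  show ?case
  proof (cases "out N u = []")
    case False
    have s: "set_pmf (pmf_of_set {..<length (out N u)}) = {..<length (out N u)}"
      using False by (intro set_pmf_of_set) auto
    from step.prems False obtain i es' where i: "i < length (out N u)"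
      and es': "es' \<in> set_pmf (random_path_from N (out N u ! i))" "es = (u, i) # es'"
      by (subst (asm) random_path_from_rec[OF assms(1)]) (auto simp: s)
    with step.IH[OF i es'(1)] random_path_from_avoids[OF assms(1) nth_mem[OF i] es'(1)]
    show ?thesis by simp
  qed (use step.prems in \<open>simp add: random_path_from_rec[OF assms(1)]\<close>)
qed

subsection \<open>Effect of a step on the paths\<close>

text \<open>The longer list is presented as a reindexing of the old one by the index map of
  \<open>uniform_after_duplication\<close>.\<close>

lemma out_parallel_step:
  "i < length (out N x) \<Longrightarrow> out (parallel_step (x, i) N) x
    = map (\<lambda>j. out N x ! (if j \<le> i then j else j - 1)) [0..<Suc (length (out N x))]"
  "u \<noteq> x \<Longrightarrow> out (parallel_step (x, i) N) u = out N u"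
proof -
  assume i: "i < length (out N x)"
  then have "min (length (out N x)) (Suc i) = Suc i" by simp
  with i show "out (parallel_step (x, i) N) x
    = map (\<lambda>j. out N x ! (if j \<le> i then j else j - 1)) [0..<Suc (length (out N x))]"
    by (intro nth_equalityI) (auto simp: parallel_step_def Let_def nth_append nth_Cons' less_Suc_eq_le simp del: upt_Suc
        intro!: arg_cong[of _ _ "(!) (out N x)"])
qed (simp add: parallel_step_def Let_def)

lemma edge_iff: "network_inv n N \<Longrightarrow> (x, i) \<in> edges N \<longleftrightarrow> i < length (out N x)"
  unfolding network_inv_def edges_def outdegree_def by force

text \<open>If \<open>x\<close> is not reachable from \<open>u\<close>, the walk never consults the
  modified list. Here even the laws of the paths agree, not merely those of their lengths.\<close>

lemma random_path_from_parallel_step_below: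
  assumes "network_inv n N" "i < length (out N x)" "(x, u) \<notin> (succ_rel N)\<^sup>*"
  shows "random_path_from (parallel_step (x, i) N) u = random_path_from N u"
  using assms(1,3)
proof (induction u rule: network_induct)
  case (step u)
  have inv: "network_inv (Suc n) (parallel_step (x, i) N)"
    using assms by (intro network_inv_parallel_step) (simp_all add: edge_iff)
  from step.prems have ux: "u \<noteq> x" by auto
  have "random_path_from (parallel_step (x, i) N) (out N u ! j) = random_path_from N (out N u ! j)"
    if j: "j < length (out N u)" for j
  proof (intro step.IH[OF j] notI)
    assume "(x, out N u ! j) \<in> (succ_rel N)\<^sup>*"
    moreover have "(out N u ! j, u) \<in> succ_rel N" using j by (simp add: succ_rel_def)
    ultimately show False using step.prems by (meson rtrancl.rtrancl_into_rtrancl)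
  qed
  moreover have "set_pmf (pmf_of_set {..<length (out N u)}) = {..<length (out N u)}" if "out N u \<noteq> []"
    using that by (intro set_pmf_of_set) auto
  ultimately show ?case
    by (subst random_path_from_rec[OF inv], subst random_path_from_rec[OF assms(1)])
      (auto simp: out_parallel_step(2)[OF ux] intro!: bind_pmf_cong)
qed

lemma length_random_path_from_rec:
  assumes "network_inv n N"
  shows "map_pmf length (random_path_from N x) = (if out N x = [] then return_pmf 0
    else pmf_of_set {..<length (out N x)} \<bind>
      (\<lambda>i. map_pmf Suc (map_pmf length (random_path_from N (out N x ! i)))))"
  by (subst random_path_from_rec[OF assms]) (simp add: map_bind_pmf pmf.map_comp o_def)

text \<open>
  Doubling a uniformly chosen edge of \<open>x\<close> and then leaving \<open>x\<close> along a uniformly chosen edge is,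
  up to the identification of the two copies, just leaving \<open>x\<close> along a uniformly chosen edge.
\<close>

lemma length_random_path_parallel_step:
  assumes inv: "network_inv n N" and x: "out N x \<noteq> []"
  shows "pmf_of_set {..<length (out N x)} \<bind>
      (\<lambda>i. map_pmf length (random_path_from (parallel_step (x, i) N) u))
    = map_pmf length (random_path_from N u)"
  using inv
proof (induction u rule: network_induct)
  case (step u)
  let ?d = "length (out N x)" and ?N = "\<lambda>i. parallel_step (x, i) N"
  have sd: "set_pmf (pmf_of_set {..<length (out N y)}) = {..<length (out N y)}" if "out N y \<noteq> []" for y
    using that by (intro set_pmf_of_set) auto
  have invp: "network_inv (Suc n) (?N i)" if "i < ?d" for i
    using that inv by (intro network_inv_parallel_step) (simp_all add: edge_iff)
  consider "out N u = []" | "out N u \<noteq> []" "u \<noteq> x" | "u = x" by blast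
  then show ?case
  proof cases
    case 1
    with x have "u \<noteq> x" by auto
    then have "pmf_of_set {..<?d} \<bind> (\<lambda>i. map_pmf length (random_path_from (?N i) u))
       = pmf_of_set {..<?d} \<bind> (\<lambda>i. return_pmf 0)"
      using 1 x by (intro bind_pmf_cong refl)
        (subst length_random_path_from_rec[OF invp], auto simp: sd out_parallel_step)
    with 1 show ?thesis by (simp add: random_path_from_rec[OF inv])
  next
    case 2
    let ?k = "length (out N u)"
    have "pmf_of_set {..<?d} \<bind> (\<lambda>i. map_pmf length (random_path_from (?N i) u))
       = pmf_of_set {..<?d} \<bind> (\<lambda>i. pmf_of_set {..<?k} \<bind>
           (\<lambda>j. map_pmf Suc (map_pmf length (random_path_from (?N i) (out N u ! j)))))"
      using 2 x by (intro bind_pmf_cong refl)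
        (subst length_random_path_from_rec[OF invp], auto simp: sd out_parallel_step)
    \<comment> \<open>The induction hypothesis concerns the average over the doubled position
      \<open>i\<close>, so this draw is moved inside the independent choice of the outgoing edge of
      \<open>u\<close>.\<close>
    also have "\<dots> = pmf_of_set {..<?k} \<bind> (\<lambda>j. map_pmf Suc (pmf_of_set {..<?d} \<bind>
           (\<lambda>i. map_pmf length (random_path_from (?N i) (out N u ! j)))))"
      by (subst bind_commute_pmf) (simp add: map_bind_pmf)
    also have "\<dots> = pmf_of_set {..<?k} \<bind>
           (\<lambda>j. map_pmf Suc (map_pmf length (random_path_from N (out N u ! j))))"
      using 2 by (intro bind_pmf_cong refl arg_cong[of _ _ "map_pmf Suc"] step.IH) (simp add: sd)
    also have "\<dots> = map_pmf length (random_path_from N u)"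
      using 2 by (simp add: length_random_path_from_rec[OF inv, of u])
    finally show ?thesis .
  next
    case 3
    let ?r = "\<lambda>i j. if j \<le> i then j else j - 1"
    let ?f = "\<lambda>k. map_pmf Suc (map_pmf length (random_path_from N (out N x ! k)))"
    have sS: "set_pmf (pmf_of_set {..<Suc ?d}) = {..<Suc ?d}"
      by (intro set_pmf_of_set) auto
    have "map_pmf length (random_path_from (?N i) x)
        = map_pmf (?r i) (pmf_of_set {..<Suc ?d}) \<bind> ?f" if i: "i < ?d" for i
    proof -
      have "map_pmf length (random_path_from (?N i) x) = pmf_of_set {..<Suc ?d} \<bind>
           (\<lambda>j. map_pmf Suc (map_pmf length (random_path_from (?N i) (out N x ! ?r i j))))"
        by (subst length_random_path_from_rec[OF invp[OF i]], subst (1 2 3) out_parallel_step(1)[OF i])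
          (auto simp: sS simp del: upt_Suc intro!: bind_pmf_cong)
      \<comment> \<open>Having left \<open>x\<close>, the walk cannot come back to it, so the
        remainder may be run in the old network.\<close>
      also have "\<dots> = pmf_of_set {..<Suc ?d} \<bind> (\<lambda>j. ?f (?r i j))"
      proof (intro bind_pmf_cong refl arg_cong[of _ _ "map_pmf Suc"] arg_cong[of _ _ "map_pmf length"]
          random_path_from_parallel_step_below[OF inv i])
        fix j assume "j \<in> set_pmf (pmf_of_set {..<Suc ?d})"
        then have "?r i j < ?d" using i x by (auto simp: sS)
        then have "(out N x ! ?r i j, x) \<in> succ_rel N" by (simp add: succ_rel_def)
        with wf_succ_rel[OF inv] show "(x, out N x ! ?r i j) \<notin> (succ_rel N)\<^sup>*"
          by (meson acyclic_def rtrancl_into_trancl1 wf_acyclic)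
      qed
      finally show ?thesis by (simp add: bind_map_pmf)
    qed
    then have "pmf_of_set {..<?d} \<bind> (\<lambda>i. map_pmf length (random_path_from (?N i) x))
      = pmf_of_set {..<?d} \<bind> (\<lambda>i. map_pmf (?r i) (pmf_of_set {..<Suc ?d})) \<bind> ?f"
      using x by (subst bind_assoc_pmf) (intro bind_pmf_cong refl, simp add: sd)
    also have "\<dots> = pmf_of_set {..<?d} \<bind> ?f"
      using x by (subst uniform_after_duplication) simp_all
    also have "\<dots> = map_pmf length (random_path_from N x)"
      using x by (simp add: length_random_path_from_rec[OF inv, of x])
    finally show ?thesis using 3 by simp
  qed
qed

text \<open>The copy is inserted to the right of the chosen edge, so the target at position 0
  survives in every list. Hence equality holds for each edge, without averaging.\<close>

lemma leftmost_path_parallel_step: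
  assumes inv: "network_inv n N" and i: "i < length (out N x)"
  shows "leftmost_path_from (parallel_step (x, i) N) u = leftmost_path_from N u"
  using inv
proof (induction u rule: network_induct)
  case (step u)
  have invp: "network_inv (Suc n) (parallel_step (x, i) N)"
    using i inv by (intro network_inv_parallel_step) (simp_all add: edge_iff)
  have "out (parallel_step (x, i) N) u = [] \<longleftrightarrow> out N u = []"
    using i by (cases "u = x") (auto simp: out_parallel_step)
  moreover have "out (parallel_step (x, i) N) u ! 0 = out N u ! 0"
    using i by (cases "u = x") (auto simp: out_parallel_step simp del: upt_Suc)
  ultimately show ?case using step[of 0]
    by (subst leftmost_path_from_rec[OF invp], subst leftmost_path_from_rec[OF inv]) auto
qed

lemma fresh_node_notin: "network_inv n N \<Longrightarrow> fresh_node N \<notin> nodes N"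
  using Max_ge[of "nodes N" "fresh_node N"] unfolding fresh_node_def network_inv_def
  by (metis Suc_n_not_le_n)

lemma out_serial_step:
  assumes "network_inv n N" "i < length (out N x)"
  shows "out (serial_step (x, i) N) x = (out N x)[i := fresh_node N]"
    and "out (serial_step (x, i) N) (fresh_node N) = [out N x ! i]"
    and "u \<noteq> x \<Longrightarrow> u \<in> nodes N \<Longrightarrow> out (serial_step (x, i) N) u = out N u"
proof -
  have "(x, i) \<in> edges N" using assms by (simp add: edge_iff)
  then have "x \<in> nodes N" by (simp add: edges_def)
  with fresh_node_notin[OF assms(1)]
  show "out (serial_step (x, i) N) x = (out N x)[i := fresh_node N]"
    "out (serial_step (x, i) N) (fresh_node N) = [out N x ! i]"
    "u \<noteq> x \<Longrightarrow> u \<in> nodes N \<Longrightarrow> out (serial_step (x, i) N) u = out N u"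
    by (auto simp: serial_step_def Let_def)
qed

text \<open>Subdivision keeps all out-degrees of old nodes and all positions, so the random choices
  in both networks correspond one to one. The fresh node offers no choice and costs one extra edge,
  paid exactly by the walks that use \<open>(x, i)\<close>.\<close>

lemma length_random_path_serial_step:
  assumes inv: "network_inv n N" and i: "i < length (out N x)" and u: "u \<in> nodes N"
  shows "map_pmf length (random_path_from (serial_step (x, i) N) u)
    = map_pmf (\<lambda>es. length es + of_bool ((x, i) \<in> set es)) (random_path_from N u)"
  using inv u
proof (induction u rule: network_induct)
  case (step u)
  let ?N = "serial_step (x, i) N" and ?z = "fresh_node N"
  let ?g = "\<lambda>es. length es + of_bool ((x, i) \<in> set es)"
  have invs: "network_inv (Suc n) ?N"
    using i inv by (intro network_inv_serial_step) (simp_all add: edge_iff)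
  have sd: "set_pmf (pmf_of_set {..<length (out N y)}) = {..<length (out N y)}" if "out N y \<noteq> []" for y
    using that by (intro set_pmf_of_set) auto
  have IH: "map_pmf length (random_path_from ?N (out N u ! j)) = map_pmf ?g (random_path_from N (out N u ! j))"
    if "j < length (out N u)" for j
    using that inv nth_mem[OF that] by (intro step.IH) (auto simp: network_inv_def simp del: nth_mem)
  consider "out N u = []" | "out N u \<noteq> []" "u \<noteq> x" | "u = x" by blast
  then show ?case
  proof cases
    case 1
    with i have "u \<noteq> x" by auto
    with 1 show ?thesis
      by (subst length_random_path_from_rec[OF invs], subst random_path_from_rec[OF inv])
        (simp add: out_serial_step(3)[OF inv i _ step.prems])
  next
    case 2
    then have "map_pmf length (random_path_from ?N u) = pmf_of_set {..<length (out N u)} \<bind>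
      (\<lambda>j. map_pmf Suc (map_pmf length (random_path_from ?N (out N u ! j))))"
      by (subst length_random_path_from_rec[OF invs]) (simp add: out_serial_step(3)[OF inv i _ step.prems])
    also have "\<dots> = pmf_of_set {..<length (out N u)} \<bind>
      (\<lambda>j. map_pmf Suc (map_pmf ?g (random_path_from N (out N u ! j))))"
      using 2 by (intro bind_pmf_cong refl arg_cong[of _ _ "map_pmf Suc"] IH) (simp add: sd)
    also have "\<dots> = map_pmf ?g (random_path_from N u)"
      using 2 by (subst (2) random_path_from_rec[OF inv]) (simp add: map_bind_pmf pmf.map_comp o_def)
    finally show ?thesis .
  next
    case 3
    have x: "out N x \<noteq> []" using i by auto
    have "map_pmf length (random_path_from ?N x) = pmf_of_set {..<length (out N x)} \<bind>
      (\<lambda>j. map_pmf Suc (map_pmf length (random_path_from ?N ((out N x)[i := ?z] ! j))))"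
      using x by (subst length_random_path_from_rec[OF invs]) (simp add: out_serial_step(1)[OF inv i])
    also have "\<dots> = pmf_of_set {..<length (out N x)} \<bind>
      (\<lambda>j. map_pmf (?g \<circ> Cons (x, j)) (random_path_from N (out N x ! j)))"
    proof (intro bind_pmf_cong refl)
      fix j assume "j \<in> set_pmf (pmf_of_set {..<length (out N x)})"
      with x have j: "j < length (out N x)" by (simp add: sd)
      \<comment> \<open>Whether the path from \<open>x\<close> contains \<open>(x, i)\<close> is
        decided by its first edge; the indicator vanishes on the rest.\<close>
      have avoid: "(x, i) \<notin> set es" if "es \<in> set_pmf (random_path_from N (out N x ! j))" for es
        using random_path_from_avoids[OF inv nth_mem[OF j] that] .
      have below: "map_pmf length (random_path_from ?N (out N x ! j))
          = map_pmf length (random_path_from N (out N x ! j))"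
        using IH[of j] j 3 avoid by (auto intro!: map_pmf_cong)
      show "map_pmf Suc (map_pmf length (random_path_from ?N ((out N x)[i := ?z] ! j)))
        = map_pmf (?g \<circ> Cons (x, j)) (random_path_from N (out N x ! j))"
      proof (cases "j = i")
        case False
        with j below have "map_pmf Suc (map_pmf length (random_path_from ?N ((out N x)[i := ?z] ! j)))
          = map_pmf Suc (map_pmf length (random_path_from N (out N x ! j)))" by simp
        with False avoid show ?thesis by (auto simp: pmf.map_comp intro!: map_pmf_cong)
      next
        case True
        have "map_pmf length (random_path_from ?N ?z) = map_pmf Suc (map_pmf length (random_path_from N (out N x ! i)))"
          using below True
          by (subst length_random_path_from_rec[OF invs])
            (simp add: out_serial_step(2)[OF inv i] pmf_of_set_singleton lessThan_Suc bind_return_pmf)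
        with True i avoid show ?thesis by (auto simp: pmf.map_comp intro!: map_pmf_cong)
      qed
    qed
    also have "\<dots> = map_pmf ?g (random_path_from N x)"
      using x by (subst (2) random_path_from_rec[OF inv]) (simp add: map_bind_pmf pmf.map_comp o_def)
    finally show ?thesis using 3 by simp
  qed
qed

lemma length_leftmost_path_serial_step:
  assumes inv: "network_inv n N" and i: "i < length (out N x)" and u: "u \<in> nodes N"
  shows "length (leftmost_path_from (serial_step (x, i) N) u)
    = length (leftmost_path_from N u) + of_bool ((x, i) \<in> set (leftmost_path_from N u))"
  using inv u
proof (induction u rule: network_induct)
  case (step u)
  let ?N = "serial_step (x, i) N" and ?z = "fresh_node N"
  have invs: "network_inv (Suc n) ?N"
    using i inv by (intro network_inv_serial_step) (simp_all add: edge_iff)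
  have IH: "length (leftmost_path_from ?N (out N u ! 0)) = length (leftmost_path_from N (out N u ! 0))
      + of_bool ((x, i) \<in> set (leftmost_path_from N (out N u ! 0)))" if "out N u \<noteq> []"
    using that inv nth_mem[of 0 "out N u"] by (intro step.IH) (auto simp: network_inv_def simp del: nth_mem)
  consider "out N u = []" | "out N u \<noteq> []" "u \<noteq> x" | "u = x" by blast
  then show ?case
  proof cases
    case 1
    with i have "u \<noteq> x" by auto
    with 1 show ?thesis
      by (simp add: leftmost_path_from_rec[OF invs, of u] leftmost_path_from_rec[OF inv, of u]
          out_serial_step(3)[OF inv i _ step.prems])
  next
    case 3
    have x: "out N x \<noteq> []" using i by auto
    have avoid: "(x, i) \<notin> set (leftmost_path_from N (out N x ! 0))"
      using random_path_from_avoids[OF inv _ leftmost_path_from_possible[OF inv]] x by simp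
    have "leftmost_path_from ?N ?z = (?z, 0) # leftmost_path_from ?N (out N x ! i)"
      by (subst leftmost_path_from_rec[OF invs]) (simp add: out_serial_step(2)[OF inv i])
    with IH 3 x avoid i show ?thesis
      by (auto simp: leftmost_path_from_rec[OF invs, of x] leftmost_path_from_rec[OF inv, of x]
          out_serial_step(1)[OF inv i] nth_list_update)
  qed (use i IH in \<open>auto simp: leftmost_path_from_rec[OF invs, of u]
        leftmost_path_from_rec[OF inv, of u] out_serial_step(3)[OF inv i _ step.prems]\<close>)
qed

subsection \<open>The Markov chain of path length and source degree\<close>

text \<open>The argument \<open>n\<close> is the size before the step, so \<open>m / n\<close> and
  \<open>l / n\<close> are the shares of the edges that lie on the path and that leave the
  source.\<close>

definition length_degree_step :: "real \<Rightarrow> nat \<Rightarrow> nat \<times> nat \<Rightarrow> (nat \<times> nat) pmf" where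
  "length_degree_step p n = (\<lambda>(m, l). bernoulli_pmf p \<bind> (\<lambda>b.
     if b then map_pmf (\<lambda>c. (m, l + of_bool c)) (bernoulli_pmf (real l / real n))
     else map_pmf (\<lambda>c. (m + of_bool c, l)) (bernoulli_pmf (real m / real n))))"

definition length_step :: "real \<Rightarrow> nat \<Rightarrow> nat \<Rightarrow> nat pmf" where
  "length_step p n m = bernoulli_pmf p \<bind> (\<lambda>b.
     if b then return_pmf m else map_pmf (\<lambda>c. m + of_bool c) (bernoulli_pmf (real m / real n)))"

text \<open>The index of the chains counts steps, so index \<open>n\<close> belongs to networks of size \<open>n + 1\<close>.\<close>

primrec length_degree_chain :: "real \<Rightarrow> nat \<Rightarrow> (nat \<times> nat) pmf" where
  "length_degree_chain p 0 = return_pmf (1, 1)"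
| "length_degree_chain p (Suc n) = length_degree_chain p n \<bind> length_degree_step p (Suc n)"

primrec length_chain :: "real \<Rightarrow> nat \<Rightarrow> nat pmf" where
  "length_chain p 0 = return_pmf 1"
| "length_chain p (Suc n) = length_chain p n \<bind> length_step p (Suc n)"

lemma map_fst_length_degree_step: "map_pmf fst (length_degree_step p n s) = length_step p n (fst s)"
  unfolding length_degree_step_def length_step_def
  by (cases s) (simp add: map_bind_pmf pmf.map_comp o_def if_distrib[of "map_pmf _"] cong: if_cong)

lemma map_fst_length_degree_chain: "map_pmf fst (length_degree_chain p n) = length_chain p n"
proof (induction n)
  case (Suc n)
  then show ?case
    by (simp add: map_bind_pmf map_fst_length_degree_step bind_map_pmf flip: Suc.IH)
qed simp

lemma finite_edges: "network_inv n N \<Longrightarrow> finite (edges N)"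
  by (auto simp: network_inv_def edges_def)

lemma bernoulli_step_bind:
  "bernoulli_step p N \<bind> f = bernoulli_pmf p \<bind>
     (\<lambda>b. pmf_of_set (edges N) \<bind> (\<lambda>e. f (if b then parallel_step e N else serial_step e N)))"
  unfolding bernoulli_step_def
  by (subst bind_commute_pmf) (simp add: bind_assoc_pmf bind_return_pmf)

lemma source_step [simp]:
  "source (parallel_step e N) = source N" "source (serial_step e N) = source N"
  by (cases e; simp add: parallel_step_def serial_step_def Let_def)+

lemma outdegree_parallel_step:
  "i < outdegree N x \<Longrightarrow> outdegree (parallel_step (x, i) N) u = outdegree N u + of_bool (x = u)"
  by (cases "u = x") (auto simp: outdegree_def out_parallel_step)

lemma outdegree_serial_step:
  assumes "network_inv n N" "i < outdegree N x" "u \<in> nodes N"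
  shows "outdegree (serial_step (x, i) N) u = outdegree N u"
  using out_serial_step(1,3)[OF assms(1), of i x] assms(2,3)
  by (cases "u = x") (auto simp: outdegree_def)

text \<open>An intertwining relation: growing the network and then observing length and degree has
  the same law as observing first and then moving the observation by a kernel that sees nothing
  else. This makes the pair a Markov chain in its own right.\<close>

lemma length_degree_bernoulli_step:
  assumes inv: "network_inv n N" and n: "n \<ge> 1"
  shows "bernoulli_step p N \<bind> (\<lambda>N'. map_pmf (\<lambda>es. (length es, outdegree N' (source N')))
      (random_path_from N' (source N')))
    = random_path_from N (source N) \<bind>
      (\<lambda>es. length_degree_step p n (length es, outdegree N (source N)))"
proof -
  let ?s = "source N" and ?D = "outdegree N (source N)"
  let ?F = "\<lambda>N'. map_pmf (\<lambda>es. (length es, outdegree N' (source N'))) (random_path_from N' (source N'))"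
  have fin: "finite (edges N)" and card: "card (edges N) = n" and s: "?s \<in> nodes N"
    using inv by (auto simp: finite_edges network_inv_def)
  have ne: "edges N \<noteq> {}" using card n by auto
  have edgesD: "i < outdegree N x" "x \<in> nodes N" "i < length (out N x)" if "(x, i) \<in> edges N" for x i
    using that by (auto simp: edges_def outdegree_def)
  have set_edges: "set_pmf (pmf_of_set (edges N)) = edges N" using fin ne by simp

  have parallel: "pmf_of_set (edges N) \<bind> (\<lambda>e. ?F (parallel_step e N))
    = random_path_from N ?s \<bind> (\<lambda>es. map_pmf (\<lambda>c. (length es, ?D + of_bool c)) (bernoulli_pmf (?D / n)))"
  proof -
    \<comment> \<open>Only the tail of the chosen edge is kept; its position is redrawn so that the
      doubling can be averaged out.\<close>
    have "pmf_of_set (edges N) \<bind> (\<lambda>e. ?F (parallel_step e N))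
      = pmf_of_set (edges N) \<bind> (\<lambda>e. pmf_of_set {..<outdegree N (fst e)} \<bind>
          (\<lambda>i. ?F (parallel_step (fst e, i) N)))"
      using fin ne unfolding edges_def by (intro resample_pmf_of_set_Sigma[symmetric])
    also have "\<dots> = pmf_of_set (edges N) \<bind>
        (\<lambda>e. map_pmf (\<lambda>es. (length es, ?D + of_bool (fst e = ?s))) (random_path_from N ?s))"
    proof (intro bind_pmf_cong refl)
      fix e assume "e \<in> set_pmf (pmf_of_set (edges N))"
      then obtain x i0 where e: "e = (x, i0)" "(x, i0) \<in> edges N" by (cases e) (auto simp: set_edges)
      then have x: "out N x \<noteq> []" using edgesD(3) by force
      let ?u = "pmf_of_set {..<outdegree N x}"
      have "?u \<bind> (\<lambda>i. ?F (parallel_step (x, i) N))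
        = ?u \<bind> (\<lambda>i. map_pmf (\<lambda>k. (k, ?D + of_bool (x = ?s)))
            (map_pmf length (random_path_from (parallel_step (x, i) N) ?s)))"
      proof (intro bind_pmf_cong refl)
        fix i assume "i \<in> set_pmf ?u"
        then have "i < outdegree N x"
          using x by (subst (asm) set_pmf_of_set) (auto simp: outdegree_def)
        then show "?F (parallel_step (x, i) N) = map_pmf (\<lambda>k. (k, ?D + of_bool (x = ?s)))
            (map_pmf length (random_path_from (parallel_step (x, i) N) ?s))"
          by (simp add: outdegree_parallel_step pmf.map_comp o_def)
      qed
      also have "\<dots> = map_pmf (\<lambda>k. (k, ?D + of_bool (x = ?s))) (?u \<bind>
            (\<lambda>i. map_pmf length (random_path_from (parallel_step (x, i) N) ?s)))"
        by (simp add: map_bind_pmf)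
      also have "\<dots> = map_pmf (\<lambda>k. (k, ?D + of_bool (x = ?s))) (map_pmf length (random_path_from N ?s))"
        unfolding outdegree_def using length_random_path_parallel_step[OF inv x] by simp
      finally show "pmf_of_set {..<outdegree N (fst e)} \<bind> (\<lambda>i. ?F (parallel_step (fst e, i) N))
        = map_pmf (\<lambda>es. (length es, ?D + of_bool (fst e = ?s))) (random_path_from N ?s)"
        by (simp add: e pmf.map_comp o_def)
    qed
    \<comment> \<open>The edge now enters only through its tail and is independent of the path in
      the old network, so the path can be drawn first.\<close>
    also have "\<dots> = random_path_from N ?s \<bind> (\<lambda>es. map_pmf (\<lambda>c. (length es, ?D + of_bool c))
        (map_pmf (\<lambda>e. fst e = ?s) (pmf_of_set (edges N))))"
      unfolding map_pmf_def bind_assoc_pmf bind_return_pmf by (rule bind_commute_pmf)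
    also have "map_pmf (\<lambda>e. fst e = ?s) (pmf_of_set (edges N))
        = map_pmf (\<lambda>e. e \<in> {?s} \<times> {..<?D}) (pmf_of_set (edges N))"
      by (intro map_pmf_cong refl) (auto simp: set_edges dest: edgesD(1))
    also have "\<dots> = bernoulli_pmf (card ({?s} \<times> {..<?D}) / card (edges N))"
      using s by (intro map_pmf_of_set_mem fin ne) (auto simp: edges_def)
    finally show ?thesis by (simp add: card)
  qed

  have serial: "pmf_of_set (edges N) \<bind> (\<lambda>e. ?F (serial_step e N))
    = random_path_from N ?s \<bind> (\<lambda>es. map_pmf (\<lambda>c. (length es + of_bool c, ?D)) (bernoulli_pmf (length es / n)))"
  proof -
    have "pmf_of_set (edges N) \<bind> (\<lambda>e. ?F (serial_step e N)) = pmf_of_set (edges N) \<bind>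
        (\<lambda>e. map_pmf (\<lambda>es. (length es + of_bool (e \<in> set es), ?D)) (random_path_from N ?s))"
    proof (intro bind_pmf_cong refl)
      fix e assume "e \<in> set_pmf (pmf_of_set (edges N))"
      then obtain x i where e: "e = (x, i)" "(x, i) \<in> edges N" by (cases e) (auto simp: set_edges)
      have "?F (serial_step e N)
        = map_pmf (\<lambda>k. (k, ?D)) (map_pmf length (random_path_from (serial_step (x, i) N) ?s))"
        using outdegree_serial_step[OF inv edgesD(1)[OF e(2)] s] by (simp add: e pmf.map_comp o_def)
      also have "\<dots> = map_pmf (\<lambda>es. (length es + of_bool (e \<in> set es), ?D)) (random_path_from N ?s)"
        unfolding length_random_path_serial_step[OF inv edgesD(3)[OF e(2)] s]
        by (simp add: e pmf.map_comp o_def)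
      finally show "?F (serial_step e N)
        = map_pmf (\<lambda>es. (length es + of_bool (e \<in> set es), ?D)) (random_path_from N ?s)" .
    qed
    also have "\<dots> = random_path_from N ?s \<bind> (\<lambda>es. map_pmf (\<lambda>c. (length es + of_bool c, ?D))
        (map_pmf (\<lambda>e. e \<in> set es) (pmf_of_set (edges N))))"
      unfolding map_pmf_def bind_assoc_pmf bind_return_pmf by (rule bind_commute_pmf)
    also have "\<dots> = random_path_from N ?s \<bind> (\<lambda>es. map_pmf (\<lambda>c. (length es + of_bool c, ?D))
        (bernoulli_pmf (length es / n)))"
      using distinct_random_path_from[OF inv] random_path_from_edges[OF inv]
      by (intro bind_pmf_cong refl) (simp add: map_pmf_of_set_mem[OF fin ne] distinct_card card)
    finally show ?thesis .
  qed

  have "bernoulli_step p N \<bind> ?F = bernoulli_pmf p \<bind> (\<lambda>b. random_path_from N ?s \<bind> (\<lambda>es.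
      if b then map_pmf (\<lambda>c. (length es, ?D + of_bool c)) (bernoulli_pmf (?D / n))
      else map_pmf (\<lambda>c. (length es + of_bool c, ?D)) (bernoulli_pmf (length es / n))))"
    unfolding bernoulli_step_bind
  proof (intro bind_pmf_cong refl)
    fix b
    show "pmf_of_set (edges N) \<bind> (\<lambda>e. ?F (if b then parallel_step e N else serial_step e N))
      = random_path_from N ?s \<bind> (\<lambda>es.
      if b then map_pmf (\<lambda>c. (length es, ?D + of_bool c)) (bernoulli_pmf (?D / n))
      else map_pmf (\<lambda>c. (length es + of_bool c, ?D)) (bernoulli_pmf (length es / n)))"
      using parallel serial by (cases b) simp_all
  qed
  then show ?thesis
    unfolding length_degree_step_def by (subst (asm) bind_commute_pmf) simp
qed

lemma leftmost_bernoulli_step: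
  assumes inv: "network_inv n N" and n: "n \<ge> 1"
  shows "map_pmf (\<lambda>N'. length (leftmost_path_from N' (source N'))) (bernoulli_step p N)
    = length_step p n (length (leftmost_path_from N (source N)))"
proof -
  let ?s = "source N" let ?es = "leftmost_path_from N ?s"
  have fin: "finite (edges N)" and card: "card (edges N) = n" and s: "?s \<in> nodes N"
    using inv by (auto simp: finite_edges network_inv_def)
  have ne: "edges N \<noteq> {}" using card n by auto
  have edgesD: "i < length (out N x)" if "(x, i) \<in> edges N" for x i
    using that by (auto simp: edges_def outdegree_def)
  have set_edges: "set_pmf (pmf_of_set (edges N)) = edges N" using fin ne by simp
  have es: "?es \<in> set_pmf (random_path_from N ?s)" by (rule leftmost_path_from_possible[OF inv])
  have "length (leftmost_path_from (parallel_step e N) ?s) = length ?es"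
    and "length (leftmost_path_from (serial_step e N) ?s) = length ?es + of_bool (e \<in> set ?es)"
    if "e \<in> edges N" for e
    using that edgesD[of "fst e" "snd e"] leftmost_path_parallel_step[OF inv, of "snd e" "fst e"]
      length_leftmost_path_serial_step[OF inv _ s, of "snd e" "fst e"] by simp_all
  then have "map_pmf (\<lambda>N'. length (leftmost_path_from N' (source N'))) (bernoulli_step p N)
    = bernoulli_pmf p \<bind> (\<lambda>b. pmf_of_set (edges N) \<bind> (\<lambda>e. if b then return_pmf (length ?es)
        else return_pmf (length ?es + of_bool (e \<in> set ?es))))"
    unfolding map_pmf_def bernoulli_step_bind by (intro bind_pmf_cong refl) (simp add: set_edges)
  also have "\<dots> = bernoulli_pmf p \<bind> (\<lambda>b. if b then return_pmf (length ?es)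
        else map_pmf (\<lambda>c. length ?es + of_bool c)
          (map_pmf (\<lambda>e. e \<in> set ?es) (pmf_of_set (edges N))))"
    by (intro bind_pmf_cong refl) (simp add: map_pmf_def bind_assoc_pmf bind_return_pmf)
  also have "map_pmf (\<lambda>e. e \<in> set ?es) (pmf_of_set (edges N)) = bernoulli_pmf (length ?es / n)"
    using distinct_random_path_from[OF inv es] random_path_from_edges[OF inv es]
    by (simp add: map_pmf_of_set_mem[OF fin ne] distinct_card card)
  finally show ?thesis unfolding length_step_def .
qed

lemma network_path_map_Pair:
  "network_path p n = bernoulli_network p n \<bind> (\<lambda>N. map_pmf (Pair N) (random_path_from N (source N)))"
  by (simp add: network_path_def map_pmf_def)

lemma single_edge_paths:
  "random_path_from single_edge (source single_edge) = return_pmf [(0, 0)]"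
  "leftmost_path_from single_edge (source single_edge) = [(0, 0)]"
  "outdegree single_edge (source single_edge) = 1"
proof -
  have [simp]: "source single_edge = 0" "out single_edge 0 = [1]" "out single_edge (Suc 0) = []"
    by (simp_all add: single_edge_def)
  note inv = network_inv_single_edge
  show "random_path_from single_edge (source single_edge) = return_pmf [(0, 0)]"
    by (simp add: random_path_from_rec[OF inv, of 0] random_path_from_rec[OF inv, of "Suc 0"]
        lessThan_Suc pmf_of_set_singleton bind_return_pmf)
  show "leftmost_path_from single_edge (source single_edge) = [(0, 0)]"
    by (simp add: leftmost_path_from_rec[OF inv, of 0] leftmost_path_from_rec[OF inv, of "Suc 0"])
  show "outdegree single_edge (source single_edge) = 1" by (simp add: outdegree_def)
qed

lemma length_degree_law:
  "map_pmf (\<lambda>\<omega>. (path_length \<omega>, source_degree \<omega>)) (network_path p (Suc n)) = length_degree_chain p n"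
proof -
  let ?F = "\<lambda>N. map_pmf (\<lambda>es. (length es, outdegree N (source N))) (random_path_from N (source N))"
  have "bernoulli_network p (Suc n) \<bind> ?F = length_degree_chain p n"
  proof (induction n)
    case 0
    show ?case by (simp add: bind_return_pmf single_edge_paths)
  next
    case (Suc n)
    have "bernoulli_network p (Suc (Suc n)) \<bind> ?F
      = bernoulli_network p (Suc n) \<bind> (\<lambda>N. bernoulli_step p N \<bind> ?F)"
      by (simp add: bind_assoc_pmf)
    also have "\<dots> = bernoulli_network p (Suc n) \<bind> (\<lambda>N. ?F N \<bind> length_degree_step p (Suc n))"
      by (intro bind_pmf_cong refl, subst length_degree_bernoulli_step[OF network_inv_bernoulli_network])
        (simp_all add: bind_map_pmf)
    also have "\<dots> = length_degree_chain p (Suc n)"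
      using Suc.IH by (simp flip: bind_assoc_pmf)
    finally show ?case .
  qed
  then show ?thesis
    by (simp add: network_path_map_Pair map_bind_pmf pmf.map_comp o_def path_length_def source_degree_def
        del: bernoulli_network.simps)
qed

lemma path_length_law: "map_pmf path_length (network_path p (Suc n)) = length_chain p n"
  using arg_cong[OF length_degree_law, of "map_pmf fst" p n]
  by (simp add: pmf.map_comp o_def map_fst_length_degree_chain)

lemma leftmost_path_length_law:
  "map_pmf leftmost_path_length (network_path p (Suc n)) = length_chain p n"
proof -
  let ?f = "\<lambda>N. length (leftmost_path_from N (source N))"
  have "map_pmf ?f (bernoulli_network p (Suc n)) = length_chain p n"
  proof (induction n)
    case 0
    show ?case by (simp add: single_edge_paths)
  next
    case (Suc n)
    have "map_pmf ?f (bernoulli_network p (Suc (Suc n)))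
      = bernoulli_network p (Suc n) \<bind> (\<lambda>N. map_pmf ?f (bernoulli_step p N))"
      by (simp add: map_bind_pmf)
    also have "\<dots> = bernoulli_network p (Suc n) \<bind> (\<lambda>N. length_step p (Suc n) (?f N))"
      by (intro bind_pmf_cong refl leftmost_bernoulli_step network_inv_bernoulli_network) simp_all
    also have "\<dots> = length_chain p (Suc n)"
      by (simp add: bind_map_pmf del: bernoulli_network.simps flip: Suc.IH)
    finally show ?case .
  qed
  then show ?thesis
    by (simp add: network_path_map_Pair map_bind_pmf pmf.map_comp o_def leftmost_path_length_def
        map_pmf_def[of ?f] del: bernoulli_network.simps)
qed

subsection \<open>The explicit distributions\<close>

text \<open>These bounds keep all ratios \<open>m / n\<close> and \<open>l / n\<close> in [0, 1],
  where they are genuine Bernoulli parameters, and they turn expectations over the chain into finite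
  sums.\<close>

lemma set_length_degree_chain:
  assumes "0 < p" "p < 1"
  shows "set_pmf (length_degree_chain p n) \<subseteq> {1..Suc n} \<times> {1..Suc n}"
proof (induction n)
  case (Suc n)
  have "set_pmf (length_degree_step p (Suc n) (m, l)) \<subseteq> {m..Suc m} \<times> {l..Suc l}" for m l
    using assms by (auto simp: length_degree_step_def split: if_splits)
  with Suc.IH show ?case by fastforce
qed simp

lemma set_length_chain:
  assumes "0 < p" "p < 1"
  shows "set_pmf (length_chain p n) \<subseteq> {1..Suc n}"
  using set_length_degree_chain[OF assms, of n]
  by (auto simp flip: map_fst_length_degree_chain)

lemma pmf_map_bernoulli:
  "0 \<le> q \<Longrightarrow> q \<le> 1 \<Longrightarrow> pmf (map_pmf f (bernoulli_pmf q)) y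
    = indicator {f True} y * q + indicator {f False} y * (1 - q)"
  by (auto simp: map_pmf_def pmf_bind indicator_def)

lemma pmf_length_step:
  assumes "0 < p" "p < 1" "m \<le> n" "n > 0"
  shows "pmf (length_step p n m) k
    = of_bool (m = k) * (1 - (1 - p) * m / n) + of_bool (Suc m = k) * ((1 - p) * m / n)"
  using assms unfolding length_step_def
  by (simp add: pmf_bind if_distrib[of "\<lambda>q. pmf q _"] pmf_map_bernoulli indicator_def
      field_simps of_bool_def cong: if_cong)

lemma pmf_length_degree_step:
  assumes "0 < p" "p < 1" "m \<le> n" "l \<le> n" "n > 0"
  shows "pmf (length_degree_step p n (m, l)) s
    = of_bool ((m, l) = s) * (1 - (1 - p) * m / n - p * l / n)
      + of_bool ((Suc m, l) = s) * ((1 - p) * m / n) + of_bool ((m, Suc l) = s) * (p * l / n)"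
  using assms unfolding length_degree_step_def
  by (cases s) (simp add: pmf_bind if_distrib[of "\<lambda>q. pmf q _"] pmf_map_bernoulli indicator_def
      field_simps of_bool_def cong: if_cong)

lemma pmf_length_chain_Suc:
  assumes "0 < p" "p < 1"
  shows "pmf (length_chain p (Suc n)) (Suc k)
    = pmf (length_chain p n) (Suc k) * (1 - (1 - p) * (real k + 1) / (real n + 1))
      + pmf (length_chain p n) k * ((1 - p) * k / (real n + 1))"
proof -
  \<comment> \<open>Covers the case where \<open>k\<close> or \<open>Suc k\<close> falls outside the
    range of the sum below and its term is therefore missing.\<close>
  have zero: "pmf (length_chain p n) j = 0" if "j > Suc n" for j
    using set_length_chain[OF assms, of n] that by (auto simp: set_pmf_iff)
  have "pmf (length_chain p (Suc n)) (Suc k)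
      = (\<Sum>m\<le>Suc n. pmf (length_chain p n) m * pmf (length_step p (Suc n) m) (Suc k))"
    using set_length_chain[OF assms, of n]
    by (simp only: length_chain.simps pmf_bind, subst integral_measure_pmf[of "{..Suc n}"]) auto
  also have "\<dots> = (\<Sum>m\<le>Suc n. pmf (length_chain p n) m *
     (of_bool (m = Suc k) * (1 - (1 - p) * m / Suc n) + of_bool (Suc m = Suc k) * ((1 - p) * m / Suc n)))"
    using assms by (intro sum.cong refl) (subst pmf_length_step, auto)
  also have "\<dots> = (\<Sum>m\<le>Suc n. if m = Suc k then pmf (length_chain p n) m * (1 - (1 - p) * m / Suc n) else 0)
     + (\<Sum>m\<le>Suc n. if m = k then pmf (length_chain p n) m * ((1 - p) * m / Suc n) else 0)"
    unfolding sum.distrib[symmetric] by (intro sum.cong refl) (simp add: of_bool_def)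
  finally show ?thesis using zero[of k] zero[of "Suc k"]
    by (auto simp: not_le not_less ac_simps simp del: length_chain.simps sum.atMost_Suc)
qed

lemma pmf_length_degree_chain_Suc:
  assumes "0 < p" "p < 1"
  shows "pmf (length_degree_chain p (Suc n)) (Suc k, Suc l)
    = pmf (length_degree_chain p n) (Suc k, Suc l) * (1 - (1 - p) * (real k + 1) / (real n + 1) - p * (real l + 1) / (real n + 1))
      + pmf (length_degree_chain p n) (k, Suc l) * ((1 - p) * k / (real n + 1))
      + pmf (length_degree_chain p n) (Suc k, l) * (p * l / (real n + 1))"
proof -
  let ?P = "pmf (length_degree_chain p n)" and ?A = "{..Suc n} \<times> {..Suc n}"
  have zero: "?P j = 0" if "j \<notin> ?A" for j
    using set_length_degree_chain[OF assms, of n] that by (auto simp: set_pmf_iff)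
  have "pmf (length_degree_chain p (Suc n)) (Suc k, Suc l)
      = (\<Sum>s\<in>?A. ?P s * pmf (length_degree_step p (Suc n) s) (Suc k, Suc l))"
    using set_length_degree_chain[OF assms, of n]
    by (simp only: length_degree_chain.simps pmf_bind, subst integral_measure_pmf[of ?A]) auto
  also have "\<dots> = (\<Sum>s\<in>?A. ?P s *
     (of_bool (s = (Suc k, Suc l)) * (1 - (1 - p) * fst s / Suc n - p * snd s / Suc n)
      + of_bool (s = (k, Suc l)) * ((1 - p) * fst s / Suc n)
      + of_bool (s = (Suc k, l)) * (p * snd s / Suc n)))"
  proof (intro sum.cong refl arg_cong2[of _ _ _ _ "(*)"])
    fix s assume s: "s \<in> ?A"
    obtain m d where [simp]: "s = (m, d)" by force
    show "pmf (length_degree_step p (Suc n) s) (Suc k, Suc l) =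
      of_bool (s = (Suc k, Suc l)) * (1 - (1 - p) * fst s / Suc n - p * snd s / Suc n)
      + of_bool (s = (k, Suc l)) * ((1 - p) * fst s / Suc n)
      + of_bool (s = (Suc k, l)) * (p * snd s / Suc n)"
      using assms s by (simp add: pmf_length_degree_step)
  qed
  also have "\<dots> =
     (\<Sum>s\<in>?A. if s = (Suc k, Suc l) then ?P s * (1 - (1 - p) * fst s / Suc n - p * snd s / Suc n) else 0)
     + (\<Sum>s\<in>?A. if s = (k, Suc l) then ?P s * ((1 - p) * fst s / Suc n) else 0)
     + (\<Sum>s\<in>?A. if s = (Suc k, l) then ?P s * (p * snd s / Suc n) else 0)"
    unfolding sum.distrib[symmetric] by (intro sum.cong refl) (simp add: of_bool_def)
  finally show ?thesis using zero[of "(k, Suc l)"] zero[of "(Suc k, l)"] zero[of "(Suc k, Suc l)"]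
    by (auto simp: sum.delta ac_simps simp del: length_degree_chain.simps)
qed

text \<open>
  The signed binomial coefficients \<open>\<lambda>k. (-1)^j (k choose j)\<close> diagonalise the birth operator
  \<open>f \<mapsto> (\<lambda>k. k f (k - 1) - (real k + 1) f k)\<close>; the eigenvalue is \<open>-(j + 1)\<close>.
\<close>

definition signed_binomial_sum :: "(nat \<Rightarrow> real) \<Rightarrow> nat \<Rightarrow> real" where
  "signed_binomial_sum b k = (\<Sum>j\<le>k. real (k choose j) * (-1) ^ j * b j)"

text \<open>Absorption, k C(k - 1, j) = (k - j) C(k, j), puts the factor k - j on the first sum;
  subtracting k + 1 leaves -(j + 1), free of \<open>k\<close>. The term j = k then vanishes, so both
  sums run over j \<le> k, and the factor \<open>k\<close> makes the truncated \<open>k - 1\<close>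
  harmless at 0.\<close>

lemma signed_binomial_sum_birth:
  "k * signed_binomial_sum b (k - 1) - (real k + 1) * signed_binomial_sum b k
    = signed_binomial_sum (\<lambda>j. - (real j + 1) * b j) k"
proof -
  have "k * signed_binomial_sum b (k - 1) = (\<Sum>j\<le>k. (real k - j) * real (k choose j) * (-1) ^ j * b j)"
  proof (cases k)
    case (Suc k')
    have "Suc k' * signed_binomial_sum b k' = (\<Sum>j\<le>k'. (real k - j) * real (k choose j) * (-1) ^ j * b j)"
      unfolding signed_binomial_sum_def sum_distrib_left
    proof (intro sum.cong refl)
      fix j assume "j \<in> {..k'}"
      then have "(k - j) * (k choose j) = Suc k' * (k' choose j)"
        using binomial_absorb_comp[of k j] Suc by simp
      then have "(real k - j) * real (k choose j) = Suc k' * real (k' choose j)"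
        using \<open>j \<in> {..k'}\<close> Suc by (metis atMost_iff le_Suc_eq of_nat_diff of_nat_mult)
      then show "Suc k' * (real (k' choose j) * (-1) ^ j * b j) = (real k - j) * real (k choose j) * (-1) ^ j * b j"
        by (simp only: mult.assoc[symmetric])
    qed
    then show ?thesis by (simp add: Suc)
  qed simp
  then show ?thesis
    unfolding signed_binomial_sum_def sum_distrib_left
    by (simp add: sum_subtractf[symmetric] algebra_simps sum_negf[symmetric])
qed

text \<open>The binomial expansion of (1 - 1)^k. It represents the initial unit mass with all
  coefficients equal to one.\<close>

lemma signed_binomial_sum_1: "signed_binomial_sum (\<lambda>_. 1) k = of_bool (k = 0)"
proof -
  have "signed_binomial_sum (\<lambda>_. 1) k = (-1 + 1) ^ k"
    unfolding binomial_ring signed_binomial_sum_def by simp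
  then show ?thesis by (cases k) auto
qed

lemma signed_binomial_sum_linear:
  "signed_binomial_sum (\<lambda>j. c * f j + d * g j) k
    = c * signed_binomial_sum f k + d * signed_binomial_sum g k"
  unfolding signed_binomial_sum_def by (simp add: sum.distrib sum_distrib_left algebra_simps)

text \<open>A mode of rate x + 1 is multiplied by 1 - (x + 1) / (n + 1) when the chain goes from
  index \<open>n\<close> to \<open>Suc n\<close>. The product of these factors is the alternating
  generalised binomial coefficient, so the explicit formulas solve the recursion mode by
  mode.\<close>

lemma gbinomial_Suc_alternating:
  fixes x :: real
  shows "(-1) ^ Suc n * (x gchoose Suc n) = (1 - (x + 1) / (real n + 1)) * ((-1) ^ n * (x gchoose n))"
proof -
  have "(real n + 1) * (x gchoose Suc n) = (x - n) * (x gchoose n)"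
    using gbinomial_mult_1[of x n] by (simp add: algebra_simps)
  then have "x gchoose Suc n = (x - n) / (real n + 1) * (x gchoose n)"
    by (simp add: field_simps)
  moreover have "1 - (x + 1) / (real n + 1) = - ((x - n) / (real n + 1))" by (simp add: field_simps)
  ultimately show ?thesis by simp
qed

lemma pmf_length_chain:
  assumes "0 < p" "p < 1"
  shows "pmf (length_chain p n) (Suc k)
    = signed_binomial_sum (\<lambda>j. (-1) ^ n * ((real j - p * (real j + 1)) gchoose n)) k"
proof (induction n arbitrary: k)
  case 0
  show ?case by (simp add: signed_binomial_sum_1 indicator_def)
next
  case (Suc n)
  define b where "b n j = (-1) ^ n * ((real j - p * (real j + 1)) gchoose n)" for n j
  let ?S = "signed_binomial_sum (b n)"
  have IH: "pmf (length_chain p n) (Suc k) = ?S k" for k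
    unfolding b_def by (rule Suc.IH)
  have b: "b (Suc n) = (\<lambda>j. 1 * b n j + (1 - p) / (real n + 1) * (- (real j + 1) * b n j))"
    unfolding b_def gbinomial_Suc_alternating by (rule ext) (simp add: field_simps)
  have "signed_binomial_sum (b (Suc n)) k
      = ?S k + (1 - p) / (real n + 1) * (k * ?S (k - 1) - (real k + 1) * ?S k)"
    unfolding b signed_binomial_sum_linear signed_binomial_sum_birth by (simp only: mult_1)
  \<comment> \<open>For k = 0 both sides vanish through the factor \<open>k\<close>, so state 0 and
    the truncated index do not disturb the recursion.\<close>
  moreover have "pmf (length_chain p n) k * ((1 - p) * real k / (real n + 1))
      = ?S (k - 1) * ((1 - p) * real k / (real n + 1))"
    using IH[of "k - 1"] by (cases k) simp_all
  ultimately have "pmf (length_chain p (Suc n)) (Suc k) = signed_binomial_sum (b (Suc n)) k"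
    unfolding pmf_length_chain_Suc[OF assms] IH by (simp only:) (simp add: divide_inverse algebra_simps)
  then show ?case unfolding b_def .
qed

text \<open>The two birth operators act on different coordinates, so products of the one-dimensional
  modes diagonalise their combination and the rates add.\<close>

lemma pmf_length_degree_chain:
  assumes "0 < p" "p < 1"
  shows "pmf (length_degree_chain p n) (Suc k, Suc l) = signed_binomial_sum (\<lambda>i. signed_binomial_sum
    (\<lambda>j. (-1) ^ n * (((1 - p) * real i + p * real j) gchoose n)) l) k"
proof (induction n arbitrary: k l)
  case 0
  have "signed_binomial_sum (\<lambda>i. c * 1 + 0 * 1) k = c * of_bool (k = 0)" for k c
    unfolding signed_binomial_sum_linear signed_binomial_sum_1 by simp
  then show ?case by (auto simp: signed_binomial_sum_1 indicator_def)
next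
  case (Suc n)
  define b where "b n i j = (-1) ^ n * (((1 - p) * real i + p * real j) gchoose n)" for n i j
  define T where "T n k l = signed_binomial_sum (\<lambda>i. signed_binomial_sum (b n i) l) k" for n k l
  have IH: "pmf (length_degree_chain p n) (Suc k, Suc l) = T n k l" for k l
    unfolding b_def T_def by (rule Suc.IH)
  have b: "b (Suc n) i = (\<lambda>j. 1 * (1 * b n i j + (1 - p) / (real n + 1) * (- (real i + 1) * b n i j))
      + p / (real n + 1) * (- (real j + 1) * b n i j))" for i
  proof
    fix j
    have "1 - ((1 - p) * real i + p * real j + 1) / (real n + 1)
        = 1 + (1 - p) / (real n + 1) * (- (real i + 1)) + p / (real n + 1) * (- (real j + 1))"
      by (simp add: divide_inverse algebra_simps)
    moreover have "(1 + c * u + d * v) * w = 1 * (1 * w + c * (u * w)) + d * (v * w)" for c d u v w :: real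
      by algebra
    ultimately show "b (Suc n) i j = 1 * (1 * b n i j + (1 - p) / (real n + 1) * (- (real i + 1) * b n i j))
      + p / (real n + 1) * (- (real j + 1) * b n i j)"
      unfolding b_def gbinomial_Suc_alternating by (simp only:)
  qed
  have row: "signed_binomial_sum (b (Suc n) i) l
      = 1 * (1 * signed_binomial_sum (b n i) l + (1 - p) / (real n + 1) * (- (real i + 1) * signed_binomial_sum (b n i) l))
        + p / (real n + 1) * (l * signed_binomial_sum (b n i) (l - 1) + - (real l + 1) * signed_binomial_sum (b n i) l)" for i
  proof -
    have scale: "signed_binomial_sum (\<lambda>j. c * f j) l = c * signed_binomial_sum f l" for c f
      using signed_binomial_sum_linear[of c f 0 f l] by simp
    show ?thesis
      unfolding b signed_binomial_sum_linear signed_binomial_sum_birth[symmetric] scale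
      by (simp add: algebra_simps)
  qed
  have "T (Suc n) k l = T n k l + (1 - p) / (real n + 1) * (k * T n (k - 1) l - (real k + 1) * T n k l)
      + p / (real n + 1) * (l * T n k (l - 1) - (real l + 1) * T n k l)"
    unfolding T_def row signed_binomial_sum_linear signed_binomial_sum_birth[symmetric]
    by (simp add: algebra_simps)
  moreover have "pmf (length_degree_chain p n) (k, Suc l) * ((1 - p) * real k / (real n + 1))
      = T n (k - 1) l * ((1 - p) * real k / (real n + 1))"
    using IH[of "k - 1" l] by (cases k) simp_all
  moreover have "pmf (length_degree_chain p n) (Suc k, l) * (p * real l / (real n + 1))
      = T n k (l - 1) * (p * real l / (real n + 1))"
    using IH[of k "l - 1"] by (cases l) simp_all
  ultimately have "pmf (length_degree_chain p (Suc n)) (Suc k, Suc l) = T (Suc n) k l"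
    unfolding pmf_length_degree_chain_Suc[OF assms] IH
    by (simp only:) (simp add: divide_inverse algebra_simps)
  then show ?case unfolding b_def T_def .
qed

subsection \<open>Moments of the path length\<close>

text \<open>The backward form of the transition: from \<open>m\<close> the function gains f(m + 1) -
  f(m) with probability (1 - p) m / (n + 1).\<close>

lemma expectation_length_chain_Suc:
  fixes f :: "nat \<Rightarrow> real"
  assumes "0 < p" "p < 1"
  shows "measure_pmf.expectation (length_chain p (Suc n)) f = measure_pmf.expectation (length_chain p n)
    (\<lambda>m. f m + (1 - p) / Suc n * (m * (f (Suc m) - f m)))"
proof -
  have "measure_pmf.expectation (length_step p (Suc n) m) f
      = f m + (1 - p) / Suc n * (m * (f (Suc m) - f m))" if "m \<le> Suc n" for m
  proof -
    have "measure_pmf.expectation (length_step p (Suc n) m) f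
        = (\<Sum>k\<in>{m, Suc m}. pmf (length_step p (Suc n) m) k *\<^sub>R f k)"
      using assms by (intro integral_measure_pmf) (auto simp: length_step_def split: if_splits)
    with that assms show ?thesis
      by (simp add: pmf_length_step diff_divide_distrib algebra_simps)
  qed
  moreover have "measure_pmf.expectation (length_chain p (Suc n)) f = (\<Sum>m\<le>Suc n.
     pmf (length_chain p n) m *\<^sub>R measure_pmf.expectation (length_step p (Suc n) m) f)"
    unfolding length_chain.simps using set_length_chain[OF assms, of n]
    by (intro pmf_expectation_bind) (auto simp: length_step_def)
  moreover have "measure_pmf.expectation (length_chain p n)
    (\<lambda>m. f m + (1 - p) / Suc n * (m * (f (Suc m) - f m))) = (\<Sum>m\<le>Suc n.
     pmf (length_chain p n) m *\<^sub>R (f m + (1 - p) / Suc n * (m * (f (Suc m) - f m))))"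
    using set_length_chain[OF assms, of n] by (intro integral_measure_pmf) auto
  ultimately show ?thesis by (auto intro!: sum.cong simp del: sum.atMost_Suc)
qed

text \<open>Rising factorials are eigenfunctions of f \<mapsto> m (f(m + 1) - f(m)) with eigenvalue
  \<open>r\<close>. Each step therefore multiplies the mean by 1 + r (1 - p) / (n + 1), starting
  from the rising factorial of 1, which is r!.\<close>

lemma expectation_pochhammer_length_chain:
  assumes "0 < p" "p < 1"
  shows "measure_pmf.expectation (length_chain p n) (\<lambda>m. pochhammer (real m) r)
    = fact r * (pochhammer (1 + r * (1 - p)) n / fact n)"
proof (induction n)
  case 0
  show ?case by (simp add: pochhammer_fact)
next
  case (Suc n)
  have "real m * (pochhammer (real (Suc m)) r - pochhammer (real m) r) = r * pochhammer (real m) r" for m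
    using pochhammer_rec[of "real m" r] pochhammer_rec'[of "real m" r] by (simp add: algebra_simps)
  then have "pochhammer (real m) r + (1 - p) / Suc n * (m * (pochhammer (real (Suc m)) r - pochhammer (real m) r))
      = (1 + r * (1 - p) / Suc n) * pochhammer (real m) r" for m
    by (simp add: algebra_simps)
  then have "measure_pmf.expectation (length_chain p (Suc n)) (\<lambda>m. pochhammer (real m) r)
    = (1 + r * (1 - p) / Suc n) * measure_pmf.expectation (length_chain p n) (\<lambda>m. pochhammer (real m) r)"
    unfolding expectation_length_chain_Suc[OF assms] by simp
  also have "\<dots> = fact r * (pochhammer (1 + r * (1 - p)) (Suc n) / fact (Suc n))"
    unfolding Suc.IH by (simp add: pochhammer_Suc field_simps)
  finally show ?case .
qed

lemma pochhammer_div_fact_asymptotics: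
  fixes z :: real
  assumes "z \<ge> 0"
  shows "(\<lambda>n. pochhammer (1 + z) n / fact n / real (Suc n) powr z) \<longlonglongrightarrow> 1 / Gamma (z + 1)"
proof -
  \<comment> \<open>Gauss's product for 1 / Gamma at z + 1 has one more factor in the rising
    factorial, one more power of n, and powers of n in place of n + 1; \<open>?c\<close> corrects
    all three and tends to 1.\<close>
  let ?c = "\<lambda>n::nat. real n / (z + 1 + real n) * (real n / real (Suc n)) powr z"
  have "?c \<longlonglongrightarrow> 1" using assms by real_asymp
  moreover have "rGamma_series (z + 1) \<longlonglongrightarrow> 1 / Gamma (z + 1)"
    using rGamma_series_LIMSEQ[of "z + 1"] by (simp add: rGamma_inverse_Gamma inverse_eq_divide)
  ultimately have "(\<lambda>n. rGamma_series (z + 1) n * ?c n) \<longlonglongrightarrow> 1 / Gamma (z + 1) * 1"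
    by (intro tendsto_mult)
  moreover have "\<forall>\<^sub>F n in sequentially. rGamma_series (z + 1) n * ?c n
      = pochhammer (1 + z) n / fact n / real (Suc n) powr z"
    using eventually_gt_at_top[of 0]
  proof eventually_elim
    case (elim n)
    have "exp ((z + 1) * ln (real n)) = real n powr z * real n"
      using elim by (simp add: powr_def distrib_right exp_add)
    moreover have cancel: "P * w / (f * (A * x)) * (x / w * (A / B)) = P / f / B"
      if "w \<noteq> 0" "A \<noteq> 0" "x \<noteq> 0" for P w f A x B :: real
      using that by simp
    moreover have "pochhammer (z + 1) (n + 1) = pochhammer (z + 1) n * (z + 1 + real n)"
      by (simp add: pochhammer_Suc)
    ultimately show ?case
      using elim assms
      by (simp only: rGamma_series_def powr_divide of_nat_0_le_iff add.commute[of 1 z]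
          of_real_eq_id id_apply) (rule cancel, auto)
  qed
  ultimately show ?thesis by (simp add: Lim_transform_eventually)
qed

text \<open>A rising factorial is the power of the same degree plus a Stirling combination of lower
  powers. By strong induction the lower moments have smaller order than the normalisation and drop
  out of the limit.\<close>

lemma expectation_power_length_chain_asymptotics:
  assumes "0 < p" "p < 1"
  shows "(\<lambda>n. measure_pmf.expectation (length_chain p n) (\<lambda>m. (real m / real (Suc n) powr (1 - p)) ^ r))
    \<longlonglongrightarrow> fact r / Gamma (r * (1 - p) + 1)"
proof (induction r rule: less_induct)
  case (less r)
  define E where "E n k = measure_pmf.expectation (length_chain p n) (\<lambda>m. real m ^ k)" for n k
  let ?a = "\<lambda>n::nat. real (Suc n) powr (1 - p)"
  have E: "measure_pmf.expectation (length_chain p n) (\<lambda>m. (real m / ?a n) ^ k) = E n k / ?a n ^ k" for n k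
    unfolding E_def by (simp add: power_divide)
  have poch: "measure_pmf.expectation (length_chain p n) (\<lambda>m. pochhammer (real m) r)
      = E n r + (\<Sum>k<r. stirling r k * E n k)" for n
  proof -
    have fin: "finite (set_pmf (length_chain p n))"
      using set_length_chain[OF assms, of n] by (rule finite_subset) simp
    have "measure_pmf.expectation (length_chain p n) (\<lambda>m. pochhammer (real m) r)
        = (\<Sum>k\<le>r. stirling r k * E n k)"
      unfolding stirling_pochhammer[symmetric] E_def
      by (subst Bochner_Integration.integral_sum) (auto intro!: integrable_measure_pmf_finite fin)
    also have "\<dots> = E n r + (\<Sum>k<r. stirling r k * E n k)"
      by (simp flip: lessThan_Suc_atMost)
    finally show ?thesis .
  qed
  have "(\<lambda>n. stirling r k * E n k / ?a n ^ r) \<longlonglongrightarrow> 0" if k: "k < r" for k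
  proof -
    have "(\<lambda>n. 1 / ?a n ^ (r - k)) \<longlonglongrightarrow> 0"
    proof -
      have "filterlim ?a at_top sequentially" using assms by real_asymp
      then have "filterlim (\<lambda>n. ?a n ^ (r - k)) at_top sequentially"
        using k by (intro filterlim_pow_at_top) auto
      then show ?thesis by (intro tendsto_divide_0[OF tendsto_const] filterlim_at_top_imp_at_infinity)
    qed
    then have "(\<lambda>n. stirling r k * (E n k / ?a n ^ k) * (1 / ?a n ^ (r - k)))
        \<longlonglongrightarrow> stirling r k * (fact k / Gamma (k * (1 - p) + 1)) * 0"
      using less[OF k] unfolding E by (intro tendsto_mult tendsto_const)
    moreover have "?a n ^ r = ?a n ^ k * ?a n ^ (r - k)" for n
      using k by (simp flip: power_add)
    ultimately show ?thesis by (simp add: mult.assoc)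
  qed
  then have "(\<lambda>n. \<Sum>k<r. stirling r k * E n k / ?a n ^ r) \<longlonglongrightarrow> (\<Sum>k<r. 0)"
    by (intro tendsto_sum) auto
  moreover have "(\<lambda>n. fact r * (pochhammer (1 + r * (1 - p)) n / fact n / real (Suc n) powr (r * (1 - p))))
      \<longlonglongrightarrow> fact r * (1 / Gamma (r * (1 - p) + 1))"
    using assms by (intro tendsto_mult tendsto_const pochhammer_div_fact_asymptotics) auto
  ultimately have "(\<lambda>n. fact r * (pochhammer (1 + r * (1 - p)) n / fact n / real (Suc n) powr (r * (1 - p)))
       - (\<Sum>k<r. stirling r k * E n k / ?a n ^ r)) \<longlonglongrightarrow> fact r * (1 / Gamma (r * (1 - p) + 1)) - (\<Sum>k<r. 0)"
    by (intro tendsto_diff)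
  moreover have "fact r * (pochhammer (1 + r * (1 - p)) n / fact n / real (Suc n) powr (r * (1 - p)))
       - (\<Sum>k<r. stirling r k * E n k / ?a n ^ r) = E n r / ?a n ^ r" for n
  proof -
    have "real (Suc n) powr (r * (1 - p)) = ?a n ^ r"
      by (simp add: powr_powr powr_realpow[symmetric] mult.commute)
    then have "fact r * (pochhammer (1 + r * (1 - p)) n / fact n / real (Suc n) powr (r * (1 - p)))
        = (E n r + (\<Sum>k<r. stirling r k * E n k)) / ?a n ^ r"
      unfolding poch[symmetric] expectation_pochhammer_length_chain[OF assms] by simp
    also have "\<dots> = E n r / ?a n ^ r + (\<Sum>k<r. stirling r k * E n k / ?a n ^ r)"
      by (simp only: add_divide_distrib sum_divide_distrib)
    finally show ?thesis by simp
  qed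
  ultimately show ?case unfolding E by simp
qed

subsection \<open>The method of moments\<close>

text \<open>Weak convergence only controls bounded continuous test functions; powers of this
  truncation stand in for the unbounded powers of \<open>x\<close>.\<close>

definition clip :: "real \<Rightarrow> real \<Rightarrow> real" where
  "clip K x = max (- K) (min K x)"

lemma isCont_clip_power: "isCont (\<lambda>x. clip K x ^ r) x"
  unfolding clip_def by (intro continuous_intros)

lemma abs_clip_le: "0 \<le> K \<Longrightarrow> \<bar>clip K x\<bar> \<le> K"
  by (auto simp: clip_def)

lemma abs_clip_le_abs: "0 \<le> K \<Longrightarrow> \<bar>clip K x\<bar> \<le> \<bar>x\<bar>"
  by (auto simp: clip_def)

lemma norm_clip_power_le: "0 \<le> K \<Longrightarrow> norm (clip K x ^ r) \<le> K ^ r"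
  by (simp add: power_abs abs_clip_le power_mono)

text \<open>Beyond \<open>K\<close> the factor |x| / K \<ge> 1 pays for the denominator. Since |x| >
  K \<ge> 1, the exponent can then be raised from r + 1 to an even number, which makes the bound a
  moment without absolute values.\<close>

lemma clip_power_diff_le:
  assumes K: "K \<ge> 1"
  shows "\<bar>x ^ r - clip K x ^ r\<bar> \<le> x ^ (2 * (r + 1)) / K"
proof (cases "\<bar>x\<bar> \<le> K")
  case True
  then have "clip K x = x" by (auto simp: clip_def)
  moreover have "0 \<le> x ^ (2 * (r + 1)) / K"
    using K by (intro divide_nonneg_nonneg zero_le_even_power) auto
  ultimately show ?thesis by simp
next
  case False
  have "\<bar>x ^ r - clip K x ^ r\<bar> \<le> \<bar>x\<bar> ^ r"
  proof (cases "x > 0")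
    case True
    with False K have "clip K x = K" by (auto simp: clip_def)
    moreover have "K ^ r \<le> x ^ r" "0 \<le> K ^ r" using False True K by (auto intro: power_mono)
    ultimately show ?thesis using True by simp
  next
    case x: False
    with False K have "clip K x = - K" by (auto simp: clip_def)
    moreover have "x ^ r - (- K) ^ r = (- 1) ^ r * ((- x) ^ r - K ^ r)"
      by (simp add: right_diff_distrib flip: power_mult_distrib)
    moreover have "K ^ r \<le> (- x) ^ r" "0 \<le> K ^ r" using x False K by (auto intro: power_mono)
    ultimately show ?thesis using x by (simp add: abs_mult power_abs)
  qed
  also have "\<bar>x\<bar> ^ r * K \<le> \<bar>x\<bar> ^ r * \<bar>x\<bar>" using False by (intro mult_left_mono) auto
  then have "\<bar>x\<bar> ^ r \<le> \<bar>x\<bar> ^ (r + 1) / K" using K by (simp add: pos_le_divide_eq mult.commute)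
  also have "\<bar>x\<bar> ^ (r + 1) \<le> \<bar>x\<bar> ^ (2 * (r + 1))"
    using False K by (intro power_increasing) auto
  then have "\<bar>x\<bar> ^ (r + 1) / K \<le> x ^ (2 * (r + 1)) / K"
    using K by (intro divide_right_mono) (auto simp: power_even_abs)
  finally show ?thesis .
qed

lemma (in real_distribution) integrable_clip_power:
  assumes "0 \<le> K"
  shows "integrable M (\<lambda>x. clip K x ^ r)"
proof (rule integrable_const_bound)
  show "AE x in M. norm (clip K x ^ r) \<le> K ^ r" using norm_clip_power_le[OF assms] by simp
  show "(\<lambda>x. clip K x ^ r) \<in> borel_measurable M" unfolding clip_def by measurable
qed

lemma (in real_distribution) expectation_clip_power_diff_le:
  assumes K: "K \<ge> 1" and int: "integrable M (\<lambda>x. x ^ r)" "integrable M (\<lambda>x. x ^ (2 * (r + 1)))"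
    and C: "expectation (\<lambda>x. x ^ (2 * (r + 1))) \<le> C"
  shows "\<bar>expectation (\<lambda>x. x ^ r) - expectation (\<lambda>x. clip K x ^ r)\<bar> \<le> C / K"
proof -
  have i: "integrable M (\<lambda>x. clip K x ^ r)" using K by (intro integrable_clip_power) simp
  have "\<bar>expectation (\<lambda>x. x ^ r) - expectation (\<lambda>x. clip K x ^ r)\<bar>
      = \<bar>expectation (\<lambda>x. x ^ r - clip K x ^ r)\<bar>"
    using int i by simp
  also have "\<dots> \<le> expectation (\<lambda>x. \<bar>x ^ r - clip K x ^ r\<bar>)" by (rule integral_abs_bound)
  also have "\<dots> \<le> expectation (\<lambda>x. x ^ (2 * (r + 1)) / K)"
    using int i clip_power_diff_le[OF K, of _ r]
    by (intro integral_mono) (auto intro!: integrable_abs Bochner_Integration.integrable_diff)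
  also have "\<dots> \<le> C / K" using C K by (simp add: divide_right_mono)
  finally show ?thesis .
qed

text \<open>Truncated moments pass to the weak limit. The truncation error is at most C / K both
  along the sequence and for the limit, where \<open>C\<close> bounds a higher even moment
  uniformly, so letting \<open>K\<close> grow removes the truncation.\<close>

lemma weak_limit_moments:
  fixes \<mu> :: "nat \<Rightarrow> real measure" and m :: "nat \<Rightarrow> real"
  assumes \<mu>: "\<And>n. real_distribution (\<mu> n)" and M: "real_distribution M" and conv: "weak_conv_m \<mu> M"
    and int: "\<And>n k. integrable (\<mu> n) (\<lambda>x. x ^ k)"
    and lim: "\<And>k. (\<lambda>n. \<integral>x. x ^ k \<partial>\<mu> n) \<longlonglongrightarrow> m k"
  shows "has_bochner_integral M (\<lambda>x. x ^ r) (m r)"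
proof -
  interpret \<mu>: real_distribution "\<mu> n" for n by (rule \<mu>)
  interpret M: real_distribution M by (rule M)
  have clip_conv: "(\<lambda>n. \<integral>x. clip K x ^ k \<partial>\<mu> n) \<longlonglongrightarrow> (\<integral>x. clip K x ^ k \<partial>M)" if "0 \<le> K" for K k
    using weak_conv_imp_integral_bdd_continuous_conv[OF \<mu> M conv isCont_clip_power
        norm_clip_power_le[OF that]] .
  \<comment> \<open>Even powers come before general ones because their truncations increase with the
    level, so monotone convergence yields integrability and keeps the bound
    \<open>C\<close>.\<close>
  have even_moment: "integrable M (\<lambda>x. x ^ (2 * k))"
    and even_bound: "(\<integral>x. x ^ (2 * k) \<partial>M) \<le> C" if C: "\<And>n. (\<integral>x. x ^ (2 * k) \<partial>\<mu> n) \<le> C" for k C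
  proof -
    let ?f = "\<lambda>j::nat. \<lambda>x. clip (real j) x ^ (2 * k)"
    have f_le: "?f j x \<le> x ^ (2 * k)" for j x
      using power_mono[OF abs_clip_le_abs[of j x] abs_ge_zero, of "2 * k"] by (simp add: power_even_abs)
    have f_bound: "(\<integral>x. ?f j x \<partial>M) \<le> C" for j
    proof (rule LIMSEQ_le_const2[OF clip_conv])
      have "(\<integral>x. ?f j x \<partial>\<mu> n) \<le> C" for n
      proof -
        have "(\<integral>x. ?f j x \<partial>\<mu> n) \<le> (\<integral>x. x ^ (2 * k) \<partial>\<mu> n)"
          using f_le int by (intro integral_mono \<mu>.integrable_clip_power) auto
        also note C
        finally show ?thesis .
      qed
      then show "\<exists>N. \<forall>n\<ge>N. (\<integral>x. ?f j x \<partial>\<mu> n) \<le> C" by blast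
    qed simp
    have mono_f: "mono (\<lambda>j. ?f j x)" for x
    proof (rule monoI)
      fix i j :: nat assume "i \<le> j"
      then have "\<bar>clip i x\<bar> \<le> \<bar>clip j x\<bar>" by (auto simp: clip_def)
      from power_mono[OF this, of "2 * k"] show "?f i x \<le> ?f j x" by (simp add: power_even_abs)
    qed
    have int_f: "integrable M (?f j)" for j by (rule M.integrable_clip_power) simp
    have "incseq (\<lambda>j. \<integral>x. ?f j x \<partial>M)"
      using mono_f int_f by (intro monoI integral_mono) (auto simp: mono_def)
    with f_bound obtain c where c: "(\<lambda>j. \<integral>x. ?f j x \<partial>M) \<longlonglongrightarrow> c"
      using incseq_convergent[of "\<lambda>j. \<integral>x. ?f j x \<partial>M" C] by blast
    have "(\<lambda>j. ?f j x) \<longlonglongrightarrow> x ^ (2 * k)" for x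
    proof (rule tendsto_eventually)
      show "\<forall>\<^sub>F j in sequentially. ?f j x = x ^ (2 * k)"
        using eventually_ge_at_top[of "nat \<lceil>\<bar>x\<bar>\<rceil>"]
      proof eventually_elim
        case (elim j)
        then have "\<bar>x\<bar> \<le> j" by linarith
        then have "clip j x = x" by (auto simp: clip_def)
        then show ?case by simp
      qed
    qed
    then have "has_bochner_integral M (\<lambda>x. x ^ (2 * k)) c"
      using int_f mono_f c by (intro has_bochner_integral_monotone_convergence[where f = ?f]) auto
    moreover have "c \<le> C" using c f_bound by (intro LIMSEQ_le_const2[OF c]) blast
    ultimately show "integrable M (\<lambda>x. x ^ (2 * k))" "(\<integral>x. x ^ (2 * k) \<partial>M) \<le> C"
      by (auto simp: has_bochner_integral_iff)
  qed
  have bounded: "\<exists>C. \<forall>n. (\<integral>x. x ^ k \<partial>\<mu> n) \<le> C" for k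
  proof -
    have "Bseq (\<lambda>n. \<integral>x. x ^ k \<partial>\<mu> n)" using lim by (intro convergent_imp_Bseq convergentI)
    then obtain C where "\<forall>n. norm (\<integral>x. x ^ k \<partial>\<mu> n) \<le> C" unfolding Bseq_def by blast
    then show ?thesis by (intro exI[of _ C] allI) (metis abs_le_D1 real_norm_def)
  qed
  have int_M: "integrable M (\<lambda>x. x ^ k)" for k
  proof (rule Bochner_Integration.integrable_bound)
    obtain C where "\<And>n. (\<integral>x. x ^ (2 * k) \<partial>\<mu> n) \<le> C" using bounded by blast
    from even_moment[OF this] show "integrable M (\<lambda>x. 1 + x ^ (2 * k))" by simp
    \<comment> \<open>Applied to y = x^k, this dominates every power by an even one.\<close>
    have abs_le: "\<bar>y\<bar> \<le> 1 + y\<^sup>2" for y :: real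
      using zero_le_power2[of "\<bar>y\<bar> - 1 / 2"] by (simp add: power2_diff power_divide)
    have "norm (x ^ k) \<le> norm (1 + x ^ (2 * k))" for x :: real
    proof -
      have "\<bar>x ^ k\<bar> \<le> 1 + x ^ (2 * k)" unfolding power_even_eq by (rule abs_le)
      also have "\<dots> \<le> \<bar>1 + x ^ (2 * k)\<bar>" by (rule abs_ge_self)
      finally show ?thesis unfolding real_norm_def .
    qed
    then show "AE x in M. norm (x ^ k) \<le> norm (1 + x ^ (2 * k))" by (intro AE_I2)
  qed simp
  obtain C where C: "\<And>n. (\<integral>x. x ^ (2 * (r + 1)) \<partial>\<mu> n) \<le> C" using bounded by blast
  have close: "\<bar>m r - (\<integral>x. x ^ r \<partial>M)\<bar> \<le> 2 * C / K" if K: "K \<ge> 1" for K :: real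
  proof -
    have abs_lim: "(\<lambda>n. \<bar>(\<integral>x. x ^ r \<partial>\<mu> n) - (\<integral>x. clip K x ^ r \<partial>\<mu> n)\<bar>)
        \<longlonglongrightarrow> \<bar>m r - (\<integral>x. clip K x ^ r \<partial>M)\<bar>"
      using K by (intro tendsto_rabs tendsto_diff lim clip_conv) simp
    have "\<bar>m r - (\<integral>x. clip K x ^ r \<partial>M)\<bar> \<le> C / K"
    proof (rule LIMSEQ_le_const2[OF abs_lim])
      show "\<exists>N. \<forall>n\<ge>N. \<bar>(\<integral>x. x ^ r \<partial>\<mu> n) - (\<integral>x. clip K x ^ r \<partial>\<mu> n)\<bar> \<le> C / K"
        by (intro exI[of _ 0] allI impI \<mu>.expectation_clip_power_diff_le[OF K int int C])
    qed
    moreover have "\<bar>(\<integral>x. x ^ r \<partial>M) - (\<integral>x. clip K x ^ r \<partial>M)\<bar> \<le> C / K"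
      by (rule M.expectation_clip_power_diff_le[OF K int_M int_M even_bound[OF C]])
    ultimately show ?thesis by simp
  qed
  have "(\<lambda>j. 2 * C / real (Suc j)) \<longlonglongrightarrow> 0"
    by (rule LIMSEQ_Suc[OF lim_const_over_n])
  then have "\<bar>m r - (\<integral>x. x ^ r \<partial>M)\<bar> \<le> 0"
  proof (rule LIMSEQ_le_const)
    show "\<exists>N. \<forall>j\<ge>N. \<bar>m r - (\<integral>x. x ^ r \<partial>M)\<bar> \<le> 2 * C / real (Suc j)"
      by (intro exI[of _ 0] allI impI close) simp
  qed
  then have "(\<integral>x. x ^ r \<partial>M) = m r" by simp
  with int_M show ?thesis unfolding has_bochner_integral_iff by blast
qed

lemma tight_bounded_second_moments:
  assumes \<mu>: "\<And>n. real_distribution (\<mu> n)" and int: "\<And>n. integrable (\<mu> n) (\<lambda>x. x\<^sup>2)"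
    and C: "\<And>n. (\<integral>x. x\<^sup>2 \<partial>\<mu> n) \<le> C"
  shows "tight \<mu>"
  unfolding tight_def
proof (intro conjI allI impI)
  fix \<epsilon> :: real assume \<epsilon>: "\<epsilon> > 0"
  \<comment> \<open>Markov's inequality for the square bounds the tail by |C| / K^2; the added 1
    makes this strictly less than \<epsilon> and keeps \<open>K\<close> positive.\<close>
  define K where "K = sqrt ((\<bar>C\<bar> + 1) / \<epsilon>)"
  have "(\<bar>C\<bar> + 1) / \<epsilon> > 0" using \<epsilon> by (intro divide_pos_pos) auto
  then have K: "K > 0" "K\<^sup>2 = (\<bar>C\<bar> + 1) / \<epsilon>" by (auto simp: K_def)
  have "measure (\<mu> n) {- K<..K} > 1 - \<epsilon>" for n
  proof -
    interpret real_distribution "\<mu> n" by (rule \<mu>)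
    have "prob {x \<in> space (\<mu> n). K\<^sup>2 \<le> x\<^sup>2} \<le> expectation (\<lambda>x. x\<^sup>2) / K\<^sup>2"
      using K(1) int by (intro integral_Markov_inequality_measure[where A = "{}"]) auto
    also have "\<dots> \<le> \<bar>C\<bar> / K\<^sup>2" using C[of n] by (intro divide_right_mono) auto
    also have "\<dots> < \<epsilon>" using \<epsilon> unfolding K by (simp add: field_simps)
    finally have less: "prob {x \<in> space (\<mu> n). K\<^sup>2 \<le> x\<^sup>2} < \<epsilon>" .
    have "1 - prob {- K<..K} = prob (space (\<mu> n) - {- K<..K})"
      by (subst prob_compl) auto
    also have "\<dots> \<le> prob {x \<in> space (\<mu> n). K\<^sup>2 \<le> x\<^sup>2}"
      using K(1) by (intro finite_measure_mono) (auto simp: abs_le_square_iff[symmetric])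
    finally show ?thesis using less by simp
  qed
  then show "\<exists>a b. a < b \<and> (\<forall>n. 1 - \<epsilon> < measure (\<mu> n) {a<..b})"
    using K by (intro exI[of _ "- K"] exI[of _ K]) auto
qed (rule \<mu>)

text \<open>The Taylor polynomial of degree \<open>n\<close> misses the characteristic function by
  at most 2 |t|^n E|X|^n / n!. Along even degrees the absolute moment is the moment itself, so the
  growth condition makes both characteristic functions limits of one sequence.\<close>

lemma moments_determine_distribution:
  fixes m :: "nat \<Rightarrow> real"
  assumes M1: "real_distribution M1" "\<And>k. has_bochner_integral M1 (\<lambda>x. x ^ k) (m k)"
    and M2: "real_distribution M2" "\<And>k. has_bochner_integral M2 (\<lambda>x. x ^ k) (m k)"
    and growth: "\<And>t. (\<lambda>k. t ^ k * m k / fact k) \<longlonglongrightarrow> 0"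
  shows "M1 = M2"
proof (rule Levy_uniqueness[OF M1(1) M2(1)], rule ext)
  fix t :: real
  let ?T = "\<lambda>k. \<Sum>j\<le>k. ((\<i> * t) ^ j / fact j) * m j"
  have approx: "cmod (char M t - ?T (2 * k)) \<le> 2 * (\<bar>t\<bar> ^ (2 * k) * m (2 * k) / fact (2 * k))"
    if "real_distribution M" and mom: "\<And>k. has_bochner_integral M (\<lambda>x. x ^ k) (m k)" for M k
  proof -
    interpret real_distribution M by fact
    have [simp]: "expectation (\<lambda>x. x ^ k) = m k" and "integrable M (\<lambda>x. x ^ k)" for k
      using mom by (auto simp: has_bochner_integral_iff)
    with char_approx1[of "2 * k" t] show ?thesis by (simp add: power_even_abs)
  qed
  have "(\<lambda>k. ?T (2 * k)) \<longlonglongrightarrow> char M t"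
    if "real_distribution M" "\<And>k. has_bochner_integral M (\<lambda>x. x ^ k) (m k)" for M
  proof -
    have "strict_mono (\<lambda>k::nat. 2 * k)" by (auto simp: strict_mono_def)
    from LIMSEQ_subseq_LIMSEQ[OF growth this]
    have "(\<lambda>k. 2 * (\<bar>t\<bar> ^ (2 * k) * m (2 * k) / fact (2 * k))) \<longlonglongrightarrow> 0"
      by (intro tendsto_mult_right_zero) (simp add: o_def)
    then have "(\<lambda>k. ?T (2 * k) - char M t) \<longlonglongrightarrow> 0"
      by (rule Lim_null_comparison[rotated]) (use approx[OF that] in \<open>simp add: norm_minus_commute\<close>)
    then show ?thesis by (simp add: LIM_zero_iff)
  qed
  from LIMSEQ_unique[OF this[OF M1] this[OF M2]] show "char M1 t = char M2 t" .
qed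

text \<open>No candidate for the limit is supplied: one subsequential limit provides it, and since
  all subsequential limits share the moments \<open>m\<close>, they all coincide with it.\<close>

lemma method_of_moments:
  fixes \<mu> :: "nat \<Rightarrow> real measure" and m :: "nat \<Rightarrow> real"
  assumes \<mu>: "\<And>n. real_distribution (\<mu> n)" and int: "\<And>n k. integrable (\<mu> n) (\<lambda>x. x ^ k)"
    and lim: "\<And>k. (\<lambda>n. \<integral>x. x ^ k \<partial>\<mu> n) \<longlonglongrightarrow> m k"
    and growth: "\<And>t. (\<lambda>k. t ^ k * m k / fact k) \<longlonglongrightarrow> 0"
  shows "\<exists>M. real_distribution M \<and> (\<forall>k. has_bochner_integral M (\<lambda>x. x ^ k) (m k)) \<and> weak_conv_m \<mu> M"
proof -
  have "Bseq (\<lambda>n. \<integral>x. x\<^sup>2 \<partial>\<mu> n)" using lim[of 2] by (intro convergent_imp_Bseq convergentI)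
  then obtain C where "\<And>n. (\<integral>x. x\<^sup>2 \<partial>\<mu> n) \<le> C"
    unfolding Bseq_def by (metis abs_le_D1 real_norm_def)
  with \<mu> int have tight: "tight \<mu>" by (intro tight_bounded_second_moments)
  have moments: "has_bochner_integral \<nu> (\<lambda>x. x ^ k) (m k)"
    if "strict_mono s" "real_distribution \<nu>" "weak_conv_m (\<mu> \<circ> s) \<nu>" for s \<nu> k
    using that \<mu> int LIMSEQ_subseq_LIMSEQ[OF lim that(1)]
    by (intro weak_limit_moments[of "\<mu> \<circ> s"]) (auto simp: o_def)
  obtain s M where "strict_mono s" and M: "real_distribution M" and "weak_conv_m (\<mu> \<circ> id \<circ> s) M"
    using tight_imp_convergent_subsubsequence[OF tight strict_mono_id] by blast
  then have M_moments: "has_bochner_integral M (\<lambda>x. x ^ k) (m k)" for k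
    by (intro moments[of s]) auto
  have "weak_conv_m \<mu> M"
  proof (rule tight_subseq_weak_converge[OF \<mu> M tight])
    fix s \<nu>
    assume s: "strict_mono s" and \<nu>: "real_distribution \<nu>" and conv: "weak_conv_m (\<mu> \<circ> s) \<nu>"
    from moments_determine_distribution[OF \<nu> moments[OF s \<nu> conv] M M_moments growth] conv
    show "weak_conv_m (\<mu> \<circ> s) M" by simp
  qed
  with M M_moments show ?thesis by blast
qed

subsection \<open>Growth of the Gamma function\<close>

text \<open>Euler's integral is cut down to the unit interval [K, K + 1], where the integrand is at
  least K^x / e^(K + 1). As \<open>K\<close> is free, Gamma beats every exponential.\<close>

lemma Gamma_ge_powr:
  fixes x K :: real
  assumes "x \<ge> 0" "K > 0"
  shows "K powr x / exp (K + 1) \<le> Gamma (x + 1)"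
proof -
  let ?f = "\<lambda>t. t powr x / exp t"
  have f: "(?f has_integral Gamma (x + 1)) {0..}"
    using Gamma_integral_real[of "x + 1"] assms by simp
  have sub: "{K..K + 1} \<subseteq> {0..}" using assms by auto
  have fi: "?f integrable_on {K..K + 1}"
    by (rule integrable_on_subinterval[OF has_integral_integrable[OF f] sub])
  have "K powr x / exp (K + 1) \<le> ?f t" if "t \<in> {K..K + 1}" for t
    using that assms by (intro frac_le powr_mono2) auto
  then have "integral {K..K + 1} (\<lambda>_. K powr x / exp (K + 1)) \<le> integral {K..K + 1} ?f"
    using fi by (intro integral_le) auto
  also have "\<dots> \<le> integral {0..} ?f"
    using fi f sub by (intro integral_subset_le) (auto simp: has_integral_integrable)
  finally show ?thesis using f by (simp add: integral_unique)
qed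

lemma power_over_Gamma_tendsto_0:
  fixes \<alpha> t :: real
  assumes "\<alpha> > 0"
  shows "(\<lambda>k. t ^ k / Gamma (real k * \<alpha> + 1)) \<longlonglongrightarrow> 0"
proof -
  \<comment> \<open>Chosen so that K^\<alpha> = |t| + 1, which leaves the geometric ratio |t| / (|t|
    + 1) < 1.\<close>
  define K where "K = (\<bar>t\<bar> + 1) powr (1 / \<alpha>)"
  have K: "K > 0" "K powr \<alpha> = \<bar>t\<bar> + 1" using assms by (auto simp: K_def powr_powr)
  have "norm (t ^ k / Gamma (real k * \<alpha> + 1)) \<le> exp (K + 1) * (\<bar>t\<bar> / (\<bar>t\<bar> + 1)) ^ k" for k
  proof -
    have G: "K powr (real k * \<alpha>) / exp (K + 1) \<le> Gamma (real k * \<alpha> + 1)"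
      using assms K by (intro Gamma_ge_powr) auto
    have "K powr (real k * \<alpha>) = (\<bar>t\<bar> + 1) ^ k"
      using K by (metis add_nonneg_pos abs_ge_zero mult.commute powr_powr powr_realpow zero_less_one)
    with G have G': "(\<bar>t\<bar> + 1) ^ k / exp (K + 1) \<le> Gamma (real k * \<alpha> + 1)" by simp
    have pos: "(\<bar>t\<bar> + 1) ^ k / exp (K + 1) > 0" by (simp add: add_nonneg_pos)
    then have Gamma_pos: "Gamma (real k * \<alpha> + 1) > 0" using G' by (rule less_le_trans)
    then have "norm (t ^ k / Gamma (real k * \<alpha> + 1)) = \<bar>t\<bar> ^ k / Gamma (real k * \<alpha> + 1)"
      by (simp add: power_abs)
    also have "\<dots> \<le> \<bar>t\<bar> ^ k / ((\<bar>t\<bar> + 1) ^ k / exp (K + 1))"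
      using G' pos Gamma_pos by (intro divide_left_mono mult_pos_pos) auto
    also have "\<dots> = exp (K + 1) * (\<bar>t\<bar> / (\<bar>t\<bar> + 1)) ^ k"
      unfolding power_divide by simp
    finally show ?thesis .
  qed
  moreover have "(\<lambda>k. exp (K + 1) * (\<bar>t\<bar> / (\<bar>t\<bar> + 1)) ^ k) \<longlonglongrightarrow> 0"
    by (intro tendsto_mult_right_zero LIMSEQ_realpow_zero) (auto simp: divide_less_eq)
  ultimately show ?thesis by (rule Lim_null_comparison[OF always_eventually[OF allI]])
qed

subsection \<open>The Mittag-Leffler limit\<close>

lemma prob_eq_pmf_map: "measure_pmf.prob P {\<omega>. f \<omega> = y} = pmf (map_pmf f P) y"
  by (simp add: pmf_map vimage_def)

text \<open>Passes from the step index of the chain to the size of the network, which is larger by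
  one.\<close>

lemma weak_conv_m_Suc: "weak_conv_m (\<lambda>n. \<mu> (Suc n)) M \<longleftrightarrow> weak_conv_m \<mu> M"
  unfolding weak_conv_m_def weak_conv_def
  by (intro all_cong1 imp_cong refl filterlim_sequentially_Suc)

lemma rescaled_path_length_limit:
  assumes p: "0 < p" "p < 1"
  shows "\<exists>M. mittag_leffler (1 - p) M \<and>
    weak_conv_m (\<lambda>n. distr (measure_pmf (network_path p n)) borel
      (\<lambda>\<omega>. real (path_length \<omega>) / real n powr (1 - p))) M"
proof -
  let ?X = "\<lambda>n \<omega>. real (path_length \<omega>) / real (Suc n) powr (1 - p)"
  let ?\<mu> = "\<lambda>n. distr (measure_pmf (network_path p (Suc n))) borel (?X n)"
  let ?h = "\<lambda>n k m. (real m / real (Suc n) powr (1 - p)) ^ k"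
  have "\<exists>M. real_distribution M \<and>
    (\<forall>k. has_bochner_integral M (\<lambda>x. x ^ k) (fact k / Gamma (real k * (1 - p) + 1))) \<and> weak_conv_m ?\<mu> M"
  proof (rule method_of_moments)
    show "real_distribution (?\<mu> n)" for n
      by (intro prob_space.real_distribution_distr prob_space_measure_pmf) simp
    have fin: "finite (set_pmf (map_pmf path_length (network_path p (Suc n))))" for n
      using set_length_chain[OF p, of n] unfolding path_length_law by (rule finite_subset) simp
    show "integrable (?\<mu> n) (\<lambda>x. x ^ k)" for n k
      using integrable_measure_pmf_finite[OF fin, of n "?h n k"]
      by (subst integrable_distr_eq) auto
    show "(\<lambda>n. \<integral>x. x ^ k \<partial>?\<mu> n) \<longlonglongrightarrow> fact k / Gamma (real k * (1 - p) + 1)" for k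
    proof -
      have "(\<integral>x. x ^ k \<partial>?\<mu> n) = measure_pmf.expectation (length_chain p n) (?h n k)" for n
        by (subst integral_distr) (simp_all flip: path_length_law)
      then show ?thesis using expectation_power_length_chain_asymptotics[OF p, of k] by simp
    qed
    show "(\<lambda>k. t ^ k * (fact k / Gamma (real k * (1 - p) + 1)) / fact k) \<longlonglongrightarrow> 0" for t
      using power_over_Gamma_tendsto_0[of "1 - p" t] p by simp
  qed
  then show ?thesis
    using weak_conv_m_Suc[of "\<lambda>n. distr (measure_pmf (network_path p n)) borel
      (\<lambda>\<omega>. real (path_length \<omega>) / real n powr (1 - p))"]
    unfolding mittag_leffler_def by blast
qed

lemma mittag_leffler_unique:
  assumes "\<alpha> > 0" "mittag_leffler \<alpha> M1" "mittag_leffler \<alpha> M2"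
  shows "M1 = M2"
proof (rule moments_determine_distribution)
  show "(\<lambda>k. t ^ k * (fact k / Gamma (real k * \<alpha> + 1)) / fact k) \<longlonglongrightarrow> 0" for t
    using power_over_Gamma_tendsto_0[OF assms(1), of t] by simp
qed (use assms in \<open>auto simp: mittag_leffler_def\<close>)

theorem theorem3:
  fixes p :: real
  assumes "0 < p" and "p < 1"
  shows "(\<forall>n\<ge>1. map_pmf path_length (network_path p n)
                 = map_pmf leftmost_path_length (network_path p n)) \<and>
    (\<forall>n m. 1 \<le> m \<and> m \<le> n \<longrightarrow>
       measure_pmf.prob (network_path p n) {\<omega>. path_length \<omega> = m}
       = (\<Sum>j = 0..m - 1. real ((m - 1) choose j) * (- 1) ^ (n + j - 1)
            * ((real j - p * (real j + 1)) gchoose (n - 1)))) \<and>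
    (\<exists>!M. mittag_leffler (1 - p) M) \<and>
    (\<forall>M. mittag_leffler (1 - p) M \<longrightarrow>
       weak_conv_m
         (\<lambda>n. distr (measure_pmf (network_path p n)) borel
                (\<lambda>\<omega>. real (path_length \<omega>) / real n powr (1 - p)))
         M) \<and>
    (\<forall>n l m. 1 \<le> l \<and> l \<le> n \<and> 1 \<le> m \<and> m \<le> n \<longrightarrow>
       measure_pmf.prob (network_path p n) {\<omega>. path_length \<omega> = m \<and> source_degree \<omega> = l}
       = (\<Sum>i = 0..m - 1. \<Sum>j = 0..l - 1.
            real ((m - 1) choose i) * real ((l - 1) choose j) * (- 1) ^ (n + i + j - 1)
            * (((1 - p) * real i + p * real j) gchoose (n - 1))))"
proof (intro conjI allI impI)
  note p = assms
  show "map_pmf path_length (network_path p n) = map_pmf leftmost_path_length (network_path p n)"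
    if "1 \<le> n" for n
    using that by (cases n) (simp_all only: path_length_law leftmost_path_length_law)
  show "measure_pmf.prob (network_path p n) {\<omega>. path_length \<omega> = m}
       = (\<Sum>j = 0..m - 1. real ((m - 1) choose j) * (- 1) ^ (n + j - 1)
            * ((real j - p * (real j + 1)) gchoose (n - 1)))" if "1 \<le> m \<and> m \<le> n" for n m
  proof -
    \<comment> \<open>With successors in place of \<open>n\<close> and \<open>m\<close>, the
      exponent \<open>n + j - 1\<close> becomes \<open>n' + j\<close>, and the sign splits between
      the coefficient and the alternating sum.\<close>
    have "n = Suc (n - 1)" "m = Suc (m - 1)" using that by simp_all
    then obtain n' k where [simp]: "n = Suc n'" "m = Suc k" by blast
    have "measure_pmf.prob (network_path p n) {\<omega>. path_length \<omega> = m} = pmf (length_chain p n') (Suc k)"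
      unfolding prob_eq_pmf_map by (simp add: path_length_law)
    also have "\<dots> = signed_binomial_sum (\<lambda>j. (-1) ^ n' * ((real j - p * (real j + 1)) gchoose n')) k"
      by (rule pmf_length_chain[OF p])
    also have "\<dots> = (\<Sum>j = 0..m - 1. real ((m - 1) choose j) * (- 1) ^ (n + j - 1)
            * ((real j - p * (real j + 1)) gchoose (n - 1)))"
      unfolding signed_binomial_sum_def atLeast0AtMost
      by (intro sum.cong) (simp_all add: power_add)
    finally show ?thesis .
  qed
  show "measure_pmf.prob (network_path p n) {\<omega>. path_length \<omega> = m \<and> source_degree \<omega> = l}
       = (\<Sum>i = 0..m - 1. \<Sum>j = 0..l - 1.
            real ((m - 1) choose i) * real ((l - 1) choose j) * (- 1) ^ (n + i + j - 1)
            * (((1 - p) * real i + p * real j) gchoose (n - 1)))"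
    if "1 \<le> l \<and> l \<le> n \<and> 1 \<le> m \<and> m \<le> n" for n l m
  proof -
    have "n = Suc (n - 1)" "m = Suc (m - 1)" "l = Suc (l - 1)" using that by simp_all
    then obtain n' k d where [simp]: "n = Suc n'" "m = Suc k" "l = Suc d" by blast
    have "measure_pmf.prob (network_path p n) {\<omega>. path_length \<omega> = m \<and> source_degree \<omega> = l}
        = pmf (length_degree_chain p n') (Suc k, Suc d)"
      using prob_eq_pmf_map[of _ "\<lambda>\<omega>. (path_length \<omega>, source_degree \<omega>)" "(m, l)"]
      by (simp add: length_degree_law)
    also have "\<dots> = signed_binomial_sum (\<lambda>i. signed_binomial_sum
        (\<lambda>j. (-1) ^ n' * (((1 - p) * real i + p * real j) gchoose n')) d) k"
      by (rule pmf_length_degree_chain[OF p])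
    also have "\<dots> = (\<Sum>i = 0..m - 1. \<Sum>j = 0..l - 1.
            real ((m - 1) choose i) * real ((l - 1) choose j) * (- 1) ^ (n + i + j - 1)
            * (((1 - p) * real i + p * real j) gchoose (n - 1)))"
      unfolding signed_binomial_sum_def sum_distrib_left atLeast0AtMost
      by (intro sum.cong) (simp_all add: power_add)
    finally show ?thesis .
  qed
  obtain M0 where M0: "mittag_leffler (1 - p) M0"
    and conv: "weak_conv_m (\<lambda>n. distr (measure_pmf (network_path p n)) borel
      (\<lambda>\<omega>. real (path_length \<omega>) / real n powr (1 - p))) M0"
    using rescaled_path_length_limit[OF p] by blast
  have unique: "M = M0" if "mittag_leffler (1 - p) M" for M
    using mittag_leffler_unique[OF _ that M0] p by simp
  show "\<exists>!M. mittag_leffler (1 - p) M" using M0 unique by blast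
  show "weak_conv_m (\<lambda>n. distr (measure_pmf (network_path p n)) borel
      (\<lambda>\<omega>. real (path_length \<omega>) / real n powr (1 - p))) M"
    if "mittag_leffler (1 - p) M" for M
    using conv unique[OF that] by simp
qed

end
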